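(* Let $T,S:U\to U$ be diffeomorphisms of an open set $U\subseteq \mathbb{R}^{n}$. Suppose that $\mu\in \mathcal{P}(U)$ is both $T$-invariant and $S$-invariant, and that $\mathrm{supp}(\mu) \subseteq U$ is compact. Let $m\in\mathbb{N}$ satisfy $m > 2d_{\mu}$, and assume that the periodic points of $T$ and of $S$ with degree at most $m$ satisfy the periodic point assumption (stated in the context) on $\mathrm{supp}(\mu)$. Then, for almost every $Y=(y_1,\dots,y_m)\in C^1(U,\mathbb{R}^m)$ (in the sense of prevalence), the following implication holds: if (1) there exists $x^*\in \mathcal{B}_{\mu,T}\cap \mathrm{supp}(\mu)$ such that $T^k(x^* ) = S^k(x^* )$ for $1\leq k \leq m-1$, and (2) $\hat{\mu}_{(y_j,T)}^{(m+1)} = \hat{\mu}_{(y_j,S)}^{(m+1)}$ for $1\leq j \leq m$, then $T = S$ everywhere on $\mathrm{supp}(\mu)$.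
   Context: $\mathcal{P}(X)$ denotes the Borel probability measures on a Polish space $X$. The support $\mathrm{supp}(\mu)$ is the unique closed set $C\subseteq X$ with $\mu(C)=1$ that is contained in every closed set of full $\mu$-measure. The pushforward is $(f\#\mu)(B)=\mu(f^{-1}(B))$; $\mu$ is $T$-invariant if $T\#\mu=\mu$. A diffeomorphism is a $C^1$ bijection with $C^1$ inverse. Basin of attraction: for a $T$-invariant $\mu\in\mathcal{P}(U)$ with compact support, $\mathcal{B}_{\mu,T}=\{x\in U:\lim_{N\to\infty}\frac1N\sum_{k=0}^{N-1}\phi(T^k(x))=\int_U\phi\,d\mu\ \text{ for all }\phi\in C(U)\}$, where $C(U)$ is the set of continuous real-valued functions on $U$. Box dimension: for a bounded set $A\subseteq\mathbb{R}^n$, $\mathrm{boxdim}(A)=\lim_{\varepsilon\to0}\frac{\log N(\varepsilon)}{\log(1/\varepsilon)}$, where $N(\varepsilon)$ is the number of boxes of side-length $\varepsilon$ required to cover $A$ (the limit is understood to exist wherever this notation is used). Write $d_\mu:=\mathrm{boxdim}(\mathrm{supp}(\mu))$. Periodic point assumption: for a diffeomorphism $T:U\to U$, a compact set $A\subseteq U$ and $m\in\mathbb{N}$, the periodic points of $T$ with degree at most $m$ satisfy the periodic point assumption on $A$ if for each $1\le p\le m$: (1) the set $A_p=\{x\in A: T^p(x)=x\}$ of $p$-periodic points satisfies $\mathrm{boxdim}(A_p)<p/2$ (vacuous if $A_p$ is empty); (2) the linearization $DT^p$ of each such periodic orbit has distinct eigenvalues, i.e. for each $x\in A_p$ the $n\times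 n$ matrix $DT^p(x)$ has $n$ distinct (complex) eigenvalues. Delay coordinates: for $T:U\to U$, $y:U\to\mathbb{R}$ and $k\in\mathbb{N}$, the time-delay map is $\Psi^{(k)}_{(y,T)}(x)=(y(x),y(T(x)),\dots,y(T^{k-1}(x)))\in\mathbb{R}^k$, and the delay-coordinate invariant measure is $\hat\mu^{(k)}_{(y,T)}:=\Psi^{(k)}_{(y,T)}\#\mu\in\mathcal{P}(\mathbb{R}^k)$. Prevalence: a Borel subset $\mathcal{S}$ of a completely metrizable topological vector space $V$ is prevalent if there is a finite-dimensional subspace $E\subseteq V$ (a probe space) such that for every $v\in V$, $v+e\in \mathcal{S}$ for Lebesgue-almost every $e\in E$ (Lebesgue measure on $E$ taken via coordinates in any basis). A property holds for almost every $v\in V$ if it holds for all $v$ in some prevalent set. The space $C^1(U,\mathbb{R}^k)$ carries the topology of uniform convergence on compact subsets of $U$ of functions and their first partial derivatives; this makes it a completely metrizable topological vector space. *)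

theory Defs
  imports "HOL-Probability.Probability" "HOL-Library.Function_Algebras"
begin

section \<open>Invariant measures, support, basin of attraction\<close>

text \<open>
  The Borel probability measures on a subset U of a Euclidean space are the measures on
  the restricted Borel space, so the underlying space of the measure is U itself.
\<close>

definition borel_prob_on :: "'a::topological_space set \<Rightarrow> 'a measure set" where
  "borel_prob_on U = {\<mu>. sets \<mu> = sets (restrict_space borel U) \<and> prob_space \<mu>}"

definition measure_supp :: "'a::topological_space measure \<Rightarrow> 'a set" where
  "measure_supp \<mu> = (THE C.
     closedin (top_of_set (space \<mu>)) C \<and> emeasure \<mu> C = 1 \<and>
     (\<forall>D. closedin (top_of_set (space \<mu>)) D \<and> emeasure \<mu> D = 1 \<longrightarrow> C \<subseteq> D))"

definition invariant_measure :: "('a \<Rightarrow> 'a) \<Rightarrow> 'a measure \<Rightarrow> bool" where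
  "invariant_measure T \<mu> \<longleftrightarrow> T \<in> measurable \<mu> \<mu> \<and> distr \<mu> \<mu> T = \<mu>"

definition basin :: "'a::topological_space set \<Rightarrow> 'a measure \<Rightarrow> ('a \<Rightarrow> 'a) \<Rightarrow> 'a set" where
  "basin U \<mu> T = {x \<in> U. \<forall>\<phi>::'a \<Rightarrow> real. continuous_on U \<phi> \<longrightarrow>
     (\<lambda>N. (\<Sum>k<N. \<phi> ((T ^^ k) x)) / real N) \<longlonglongrightarrow> integral\<^sup>L \<mu> \<phi>}"

section \<open>Box dimension\<close>

definition box_count :: "'a::euclidean_space set \<Rightarrow> real \<Rightarrow> nat" where
  "box_count A \<epsilon> = (LEAST k. \<exists>C. finite C \<and> card C = k \<and>
     A \<subseteq> (\<Union>a\<in>C. cbox a (a + \<epsilon> *\<^sub>R One)))"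

text \<open>As a relation, so that asserting a value includes the existence of the limit.\<close>

definition has_box_dim :: "'a::euclidean_space set \<Rightarrow> real \<Rightarrow> bool" where
  "has_box_dim A d \<longleftrightarrow> bounded A \<and>
     ((\<lambda>\<epsilon>. ln (real (box_count A \<epsilon>)) / ln (1 / \<epsilon>)) \<longlongrightarrow> d) (at_right 0)"

section \<open>Maps of class C1, diffeomorphisms, periodic points\<close>

definition C1_on :: "'a::euclidean_space set \<Rightarrow> ('a \<Rightarrow> 'b::euclidean_space) \<Rightarrow> bool" where
  "C1_on U f \<longleftrightarrow> (\<exists>f'. (\<forall>x\<in>U. (f has_derivative blinfun_apply (f' x)) (at x)) \<and>
     continuous_on U f')"

definition diffeo_on :: "'a::euclidean_space set \<Rightarrow> ('a \<Rightarrow> 'a) \<Rightarrow> bool" where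
  "diffeo_on U T \<longleftrightarrow> bij_betw T U U \<and> C1_on U T \<and> C1_on U (inv_into U T)"

definition complex_eigenvalues :: "real^'n^'n \<Rightarrow> complex set" where
  "complex_eigenvalues A =
     {z. \<exists>v. v \<noteq> 0 \<and> map_matrix complex_of_real A *v v = z *s v}"

definition periodic_points :: "('a \<Rightarrow> 'a) \<Rightarrow> 'a set \<Rightarrow> nat \<Rightarrow> 'a set" where
  "periodic_points T A p = {x \<in> A. (T ^^ p) x = x}"

definition periodic_point_assumption ::
    "(real^'n \<Rightarrow> real^'n) \<Rightarrow> (real^'n) set \<Rightarrow> nat \<Rightarrow> bool" where
  "periodic_point_assumption T A m \<longleftrightarrow> (\<forall>p\<in>{1..m}.
     (periodic_points T A p \<noteq> {} \<longrightarrow>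
        (\<exists>d. has_box_dim (periodic_points T A p) d \<and> d < real p / 2)) \<and>
     (\<forall>x\<in>periodic_points T A p.
        card (complex_eigenvalues (matrix (frechet_derivative (T ^^ p) (at x)))) = CARD('n)))"

section \<open>Delay coordinates\<close>

text \<open>
  Vectors with k real coordinates are extensional functions on the index set
  \<open>{..<k}\<close>; the product sigma-algebra on them is the Borel sigma-algebra.
\<close>

definition delay_map :: "('a \<Rightarrow> real) \<Rightarrow> ('a \<Rightarrow> 'a) \<Rightarrow> nat \<Rightarrow> 'a \<Rightarrow> (nat \<Rightarrow> real)" where
  "delay_map y T k x = (\<lambda>i\<in>{..<k}. y ((T ^^ i) x))"

definition delay_measure ::
    "'a measure \<Rightarrow> ('a \<Rightarrow> real) \<Rightarrow> ('a \<Rightarrow> 'a) \<Rightarrow> nat \<Rightarrow> (nat \<Rightarrow> real) measure" where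
  "delay_measure \<mu> y T k = distr \<mu> (PiM {..<k} (\<lambda>_. borel)) (delay_map y T k)"

section \<open>Prevalence\<close>

instantiation "fun" :: (type, real_vector) real_vector
begin

definition "r *\<^sub>R f = (\<lambda>x. r *\<^sub>R f x)"

instance
  by standard (auto simp: scaleR_fun_def fun_eq_iff scaleR_add_right scaleR_add_left)

end

text \<open>
  The topological vector space is given by a topology \<open>X\<close> whose carrier is a linear
  subspace of the ambient type. A probe space is given by a basis \<open>B\<close>, and Lebesgue
  measure on it is the product measure on coordinates with respect to \<open>B\<close>.
\<close>

definition prevalent :: "'v::real_vector topology \<Rightarrow> 'v set \<Rightarrow> bool" where
  "prevalent X S \<longleftrightarrow>
     S \<in> sigma_sets (topspace X) {W. openin X W} \<and>
     (\<exists>B. finite B \<and> independent B \<and> B \<subseteq> topspace X \<and>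
        (\<forall>v\<in>topspace X. AE c in PiM B (\<lambda>_. lborel). v + (\<Sum>b\<in>B. c b *\<^sub>R b) \<in> S))"

definition almost_every :: "'v::real_vector topology \<Rightarrow> ('v \<Rightarrow> bool) \<Rightarrow> bool" where
  "almost_every X P \<longleftrightarrow> (\<exists>S. prevalent X S \<and> (\<forall>v\<in>S. P v))"

section \<open>The space of C1 functions on an open set\<close>

text \<open>
  A function on \<open>U\<close> is represented by its extension by zero to the whole space, so that
  distinct elements differ on \<open>U\<close>. The derivatives below are only taken at points
  of the open set \<open>U\<close>.
\<close>

definition C1_space :: "'a::euclidean_space set \<Rightarrow> ('a \<Rightarrow> 'b::euclidean_space) set" where
  "C1_space U = {f. C1_on U f \<and> (\<forall>x. x \<notin> U \<longrightarrow> f x = 0)}"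

definition C1_nbhd :: "'a::euclidean_space set \<Rightarrow> ('a \<Rightarrow> 'b::euclidean_space) \<Rightarrow>
    'a set \<Rightarrow> real \<Rightarrow> ('a \<Rightarrow> 'b) set" where
  "C1_nbhd U f K \<epsilon> = {g \<in> C1_space U. \<forall>x\<in>K.
     norm (g x - f x) < \<epsilon> \<and>
     (\<forall>e\<in>Basis. norm (frechet_derivative g (at x) e - frechet_derivative f (at x) e) < \<epsilon>)}"

text \<open>
  Continuity of the functions and derivatives involved makes the strict pointwise bounds on
  a compact set equivalent to strict bounds on the maximum, so these sets form a base for
  uniform C1 convergence on compact sets.
\<close>

definition C1_topology ::
    "'a::euclidean_space set \<Rightarrow> ('a \<Rightarrow> 'b::euclidean_space) topology" where
  "C1_topology U = topology_generated_by
     {C1_nbhd U f K \<epsilon> | f K \<epsilon>. f \<in> C1_space U \<and> compact K \<and> K \<subseteq> U \<and> \<epsilon> > 0}"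

lemma topspace_C1_topology:
  "topspace (C1_topology U) = (C1_space U :: ('a::euclidean_space \<Rightarrow> 'b::euclidean_space) set)"
proof
  show "topspace (C1_topology U) \<subseteq> (C1_space U :: ('a \<Rightarrow> 'b) set)"
    unfolding C1_topology_def topology_generated_by_topspace
    by (auto simp: C1_nbhd_def)
  show "(C1_space U :: ('a \<Rightarrow> 'b) set) \<subseteq> topspace (C1_topology U)"
  proof
    fix f :: "'a \<Rightarrow> 'b" assume f: "f \<in> C1_space U"
    have "f \<in> C1_nbhd U f {} 1"
      using f by (simp add: C1_nbhd_def)
    moreover have "C1_nbhd U f {} 1 \<in>
        {C1_nbhd U f K \<epsilon> | f K \<epsilon>. f \<in> C1_space U \<and> compact K \<and> K \<subseteq> U \<and> \<epsilon> > 0}"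
      using f by (intro CollectI exI[of _ f] exI[of _ "{}"] exI[of _ 1]) simp
    ultimately show "f \<in> topspace (C1_topology U)"
      unfolding C1_topology_def topology_generated_by_topspace by (rule UnionI[rotated])
  qed
qed

lemma subspace_C1_space:
  "subspace (C1_space U :: ('a::euclidean_space \<Rightarrow> 'b::euclidean_space) set)"
proof (rule subspaceI)
  show "0 \<in> (C1_space U :: ('a \<Rightarrow> 'b) set)"
    unfolding C1_space_def C1_on_def zero_fun_def
    by (auto intro!: exI[of _ "\<lambda>_. 0"] simp: zero_blinfun.rep_eq)
next
  fix f g :: "'a \<Rightarrow> 'b" assume "f \<in> C1_space U" "g \<in> C1_space U"
  then obtain f' g' where
    "\<And>x. x \<in> U \<Longrightarrow> (f has_derivative blinfun_apply (f' x)) (at x)" "continuous_on U f'"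
    "\<And>x. x \<in> U \<Longrightarrow> (g has_derivative blinfun_apply (g' x)) (at x)" "continuous_on U g'"
    by (simp add: C1_space_def C1_on_def) metis
  then have "C1_on U (f + g)"
    unfolding C1_on_def plus_fun_def
    by (intro exI[of _ "\<lambda>x. f' x + g' x"])
       (auto simp: plus_blinfun.rep_eq intro!: derivative_intros continuous_intros)
  with \<open>f \<in> _\<close> \<open>g \<in> _\<close> show "f + g \<in> C1_space U"
    by (auto simp: C1_space_def)
next
  fix c :: real and f :: "'a \<Rightarrow> 'b" assume "f \<in> C1_space U"
  then obtain f' where
    "\<And>x. x \<in> U \<Longrightarrow> (f has_derivative blinfun_apply (f' x)) (at x)" "continuous_on U f'"
    by (auto simp: C1_space_def C1_on_def)
  then have "C1_on U (c *\<^sub>R f)"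
    unfolding C1_on_def scaleR_fun_def
    by (intro exI[of _ "\<lambda>x. c *\<^sub>R f' x"])
       (auto simp: scaleR_blinfun.rep_eq intro!: derivative_intros continuous_intros)
  with \<open>f \<in> _\<close> show "c *\<^sub>R f \<in> C1_space U"
    by (auto simp: C1_space_def scaleR_fun_def)
qed

end

theory Submission
  imports Defs
begin

text \<open>
  Hypothesis (1) does not involve \<open>Y\<close>, so the point \<open>x\<close> is fixed before \<open>Y\<close> is chosen, and
  only countably many conditions on \<open>Y\<close> matter, all anchored at the points \<open>p = T\<^sup>n x\<close>: that
  \<open>Y\<close> separates \<open>T\<^sup>n x\<close> from \<open>S\<^sup>n x\<close> when they differ, and that no other point of the support
  has the same \<open>S\<close>-delay vector of length \<open>m\<close> as \<open>p\<close> when \<open>p, S p, \<dots>, S\<^bsup>m-1\<^esup> p\<close> are distinct.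
  Each condition holds for almost every \<open>Y\<close>, with polynomials of degree at most \<open>2m\<close> as probe:
  polynomials interpolating along the orbit of \<open>p\<close> move all \<open>m\<close> coordinates of the difference
  of the delay vectors independently, and the coefficients producing a coincidence form a Lipschitz
  image of a set of box dimension less than \<open>m\<close>, hence a null set.

  Equality of the delay measures gives equality of the images of the support under the delay maps,
  so \<open>T\<^sup>i x = S\<^sup>i x\<close> propagates from \<open>i < n + m\<close> to \<open>i = n + m\<close>. The orbit of \<open>x\<close> is dense in the
  support because \<open>x\<close> lies in the basin. If \<open>x, T x, \<dots>, T\<^bsup>m-1\<^esup> x\<close> are not distinct, the support is a
  periodic orbit on which \<open>T = S\<close> is immediate from (1).
\<close>

section \<open>Shy sets\<close>

lemma sum_fun_apply: "(\<Sum>i\<in>I. f i) x = (\<Sum>i\<in>I. f i x)" for f :: "'i \<Rightarrow> 'x \<Rightarrow> 'y::comm_monoid_add"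
  by (induction I rule: infinite_finite_induct) auto

text \<open>Boxes determine the product measure, and the preimage of a box under a translation is
  again a box, so invariance of \<open>lborel\<close> in each factor suffices.\<close>

lemma PiM_lborel_translate:
  fixes a :: "'i \<Rightarrow> 'b::euclidean_space"
  assumes "finite B"
  shows "distr (PiM B (\<lambda>_. lborel)) (PiM B (\<lambda>_. lborel)) (\<lambda>c. \<lambda>b\<in>B. c b + a b)
    = PiM B (\<lambda>_. lborel :: 'b measure)" (is "distr ?N ?N ?\<tau> = _")
proof -
  interpret product_sigma_finite "\<lambda>_::'i. lborel :: 'b measure"
    by (simp add: product_sigma_finite_def sigma_finite_lborel)
  have meas: "?\<tau> \<in> measurable ?N ?N"
    by (intro measurable_restrict borel_measurable_add measurable_component_singleton)
      (auto simp: measurable_lborel1 measurable_lborel2)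
  show ?thesis
  proof (rule PiM_eqI[OF assms])
    fix A :: "'i \<Rightarrow> 'b set" assume A: "\<And>i. i \<in> B \<Longrightarrow> A i \<in> sets lborel"
    define A' where "A' i = (+) (a i) -` A i" for i
    have A': "A' i \<in> sets lborel" if "i \<in> B" for i
    proof -
      have "(+) (a i) \<in> borel_measurable borel" by measurable
      then show ?thesis
        using measurable_sets[of "(+) (a i)" borel borel "A i"] A[OF that] by (simp add: A'_def)
    qed
    have eq: "?\<tau> -` (Pi\<^sub>E B A) \<inter> space ?N = Pi\<^sub>E B A'"
      unfolding A'_def by (auto simp: space_PiM PiE_def Pi_def add.commute)
    have "emeasure (distr ?N ?N ?\<tau>) (Pi\<^sub>E B A) = emeasure ?N (Pi\<^sub>E B A')"
      using A assms by (subst emeasure_distr[OF meas]) (auto simp: eq sets_PiM_I_finite)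
    also have "\<dots> = (\<Prod>i\<in>B. emeasure lborel (A' i))"
      by (rule emeasure_PiM) (use A' assms in auto)
    also have "\<dots> = (\<Prod>i\<in>B. emeasure lborel (A i))"
    proof (rule prod.cong[OF refl])
      fix i assume "i \<in> B"
      have "emeasure lborel (A i) = emeasure (distr lborel borel ((+) (a i))) (A i)"
        by (simp add: lborel_distr_plus)
      also have "\<dots> = emeasure lborel (A' i)"
        using A[OF \<open>i \<in> B\<close>] by (subst emeasure_distr) (auto simp: A'_def)
      finally show "emeasure lborel (A' i) = emeasure lborel (A i)" by simp
    qed
    finally show "emeasure (distr ?N ?N ?\<tau>) (Pi\<^sub>E B A) = (\<Prod>i\<in>B. emeasure lborel (A i))" .
  qed simp
qed

text \<open>The notion complementary to \<open>prevalent\<close>, with two adjustments: the probe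
  basis \<open>B\<close> is a parameter, so that exceptional sets for one common probe can be united
  countably, and \<open>Q\<close> only has to lie in a Borel set \<open>N\<close> that the probe
  avoids almost surely, so that subsets inherit the property.\<close>

definition shy :: "'v::real_vector topology \<Rightarrow> 'v set \<Rightarrow> 'v set \<Rightarrow> bool" where
  "shy X B Q \<longleftrightarrow> (\<exists>N \<in> sigma_sets (topspace X) {W. openin X W}. Q \<subseteq> N \<and>
     (\<forall>v\<in>topspace X. AE c in PiM B (\<lambda>_. lborel). v + (\<Sum>b\<in>B. c b *\<^sub>R b) \<notin> N))"

lemma shy_mono: "shy X B Q \<Longrightarrow> R \<subseteq> Q \<Longrightarrow> shy X B R"
  unfolding shy_def by blast

lemma shy_empty: "shy X B {}"
  unfolding shy_def by (intro bexI[of _ "{}"]) (auto intro: sigma_sets.intros)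

lemma shy_UN:
  assumes "countable I" "\<And>i. i \<in> I \<Longrightarrow> shy X B (Q i)"
  shows "shy X B (\<Union>i\<in>I. Q i)"
proof -
  let ?null = "\<lambda>N. \<forall>v\<in>topspace X. AE c in PiM B (\<lambda>_. lborel). v + (\<Sum>b\<in>B. c b *\<^sub>R b) \<notin> N"
  have "\<forall>i\<in>I. \<exists>N. N \<in> sigma_sets (topspace X) {W. openin X W} \<and> Q i \<subseteq> N \<and> ?null N"
    using assms(2) unfolding shy_def by blast
  from bchoice[OF this] obtain N where N:
      "\<And>i. i \<in> I \<Longrightarrow> N i \<in> sigma_sets (topspace X) {W. openin X W}"
      "\<And>i. i \<in> I \<Longrightarrow> Q i \<subseteq> N i" "\<And>i. i \<in> I \<Longrightarrow> ?null (N i)"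
    by blast
  have "(\<Union>i\<in>I. N i) \<in> sigma_sets (topspace X) {W. openin X W}"
  proof -
    interpret sigma_algebra "topspace X" "sigma_sets (topspace X) {W. openin X W}"
      by (rule sigma_algebra_sigma_sets) (auto dest: openin_subset)
    show ?thesis
      using assms(1) N(1) by (intro countable_UN') auto
  qed
  moreover have "AE c in PiM B (\<lambda>_. lborel). v + (\<Sum>b\<in>B. c b *\<^sub>R b) \<notin> (\<Union>i\<in>I. N i)"
    if v: "v \<in> topspace X" for v
  proof -
    have "AE c in PiM B (\<lambda>_. lborel). \<forall>i\<in>I. v + (\<Sum>b\<in>B. c b *\<^sub>R b) \<notin> N i"
      unfolding AE_ball_countable[OF assms(1)] using N(3) v by (intro ballI) (rule bspec)
    then show ?thesis by simp
  qed
  ultimately show ?thesis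
    unfolding shy_def using UN_mono[OF order_refl N(2)]
    by (intro bexI[of _ "\<Union>i\<in>I. N i"] conjI ballI)
qed

lemma shy_Un: "shy X B Q \<Longrightarrow> shy X B R \<Longrightarrow> shy X B (Q \<union> R)"
  using shy_UN[of "{True, False}" X B "\<lambda>i. if i then Q else R"] by (auto simp: Un_commute)

text \<open>The prevalent witness is the complement of the Borel hull \<open>N\<close>; the set
  where \<open>P\<close> holds need not be Borel itself.\<close>

lemma almost_every_if_shy:
  assumes "finite B" "independent B" "B \<subseteq> topspace X" "subspace (topspace X)"
    and "shy X B {v \<in> topspace X. \<not> P v}"
  shows "almost_every X P"
proof -
  obtain N where N: "N \<in> sigma_sets (topspace X) {W. openin X W}" "{v \<in> topspace X. \<not> P v} \<subseteq> N"
      "\<And>v. v \<in> topspace X \<Longrightarrow> AE c in PiM B (\<lambda>_. lborel). v + (\<Sum>b\<in>B. c b *\<^sub>R b) \<notin> N"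
    using assms(5) unfolding shy_def by auto
  have in_top: "v + (\<Sum>b\<in>B. c b *\<^sub>R b) \<in> topspace X" if "v \<in> topspace X" for v and c :: "'a \<Rightarrow> real"
    using that assms(3,4) by (intro subspace_add subspace_sum subspace_scale) auto
  have "prevalent X (topspace X - N)"
    unfolding prevalent_def using assms N in_top
    by (intro conjI exI[of _ B]) (auto intro: sigma_sets.Compl)
  then show ?thesis
    unfolding almost_every_def using N(2) by blast
qed

text \<open>By Fubini, the bad set of coordinates is null for almost every translate along \<open>H\<close>;
  as Lebesgue measure is translation invariant, the bad set is itself null. The directions
  \<open>w e\<close> need not be linearly independent.\<close>

lemma shy_if_sections_negligible:
  fixes w :: "'b::euclidean_space \<Rightarrow> 'v::real_vector"
  assumes fin: "finite B" and sub: "subspace (topspace X)" "B \<subseteq> topspace X"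
    and w: "\<And>e. e \<in> Basis \<Longrightarrow> w e \<in> span B"
    and "Q \<subseteq> topspace X" and op: "openin X (topspace X - Q)"
    and meas: "\<And>v. v \<in> topspace X \<Longrightarrow>
      {c \<in> space (PiM B (\<lambda>_. lborel)). v + (\<Sum>b\<in>B. c b *\<^sub>R b) \<in> Q} \<in> sets (PiM B (\<lambda>_. lborel))"
    and negl: "\<And>v. v \<in> topspace X \<Longrightarrow> negligible {t. v + (\<Sum>e\<in>Basis. (t \<bullet> e) *\<^sub>R w e) \<in> Q}"
  shows "shy X B Q"
proof -
  let ?N = "PiM B (\<lambda>_. lborel) :: ('v \<Rightarrow> real) measure"
  let ?L = "lborel :: 'b measure"
  let ?lin = "\<lambda>c::'v \<Rightarrow> real. \<Sum>b\<in>B. c b *\<^sub>R b"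
  have "\<forall>e\<in>Basis. \<exists>u. w e = ?lin u"
    using w unfolding span_finite[OF fin] by blast
  then obtain u where u: "\<And>e. e \<in> Basis \<Longrightarrow> w e = ?lin (u e)"
    by metis
  \<comment> \<open>A shift by \<open>t\<close> along the directions \<open>w e\<close> becomes the
    shift by \<open>s t\<close> of the coordinates with respect to \<open>B\<close>.\<close>
  define s where "s t b = (\<Sum>e\<in>Basis. (t \<bullet> e) * u e b)" for t b
  have s: "(\<Sum>e\<in>Basis. (t \<bullet> e) *\<^sub>R w e) = ?lin (s t)" for t
  proof -
    have "(\<Sum>e\<in>Basis. (t \<bullet> e) *\<^sub>R w e) = (\<Sum>e\<in>Basis. \<Sum>b\<in>B. ((t \<bullet> e) * u e b) *\<^sub>R b)"
      by (intro sum.cong refl) (simp add: u scaleR_sum_right)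
    also have "\<dots> = ?lin (s t)"
      by (subst sum.swap) (simp add: s_def scaleR_sum_left)
    finally show ?thesis .
  qed
  define \<tau> where "\<tau> t c = (\<lambda>b\<in>B. c b + s t b)" for t c
  have lin_tau: "?lin (\<tau> t c) = ?lin c + ?lin (s t)" for t c
    by (simp add: \<tau>_def scaleR_add_left sum.distrib)
  have "AE c in ?N. v + ?lin c \<notin> Q" if v: "v \<in> topspace X" for v
  proof -
    interpret N: product_sigma_finite "\<lambda>_::'v. lborel :: real measure"
      by (simp add: product_sigma_finite_def sigma_finite_lborel)
    interpret N: sigma_finite_measure ?N
      by (rule N.sigma_finite[OF fin])
    interpret pair_sigma_finite ?N ?L
      by (simp add: pair_sigma_finite_def N.sigma_finite_measure_axioms sigma_finite_lborel)
    let ?E = "{c \<in> space ?N. v + ?lin c \<in> Q}"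
    have E: "?E \<in> sets ?N" by (rule meas[OF v])
    have [measurable]: "(\<lambda>x. s (snd x) b) \<in> borel_measurable (?N \<Otimes>\<^sub>M ?L)" for b
      unfolding s_def by measurable
    have comp: "(\<lambda>x. fst x b) \<in> borel_measurable (?N \<Otimes>\<^sub>M ?L)" if "b \<in> B" for b
    proof -
      have "(\<lambda>c. c b) \<in> measurable ?N lborel"
        using that by (rule measurable_component_singleton)
      then show ?thesis by (simp add: measurable_compose[OF measurable_fst] measurable_lborel1)
    qed
    have tau_pair: "(\<lambda>x. \<tau> (snd x) (fst x)) \<in> measurable (?N \<Otimes>\<^sub>M ?L) ?N"
      unfolding \<tau>_def
      by (rule measurable_restrict) (auto simp: measurable_lborel1 intro!: borel_measurable_add comp)
    have tau_space: "\<tau> t c \<in> space ?N" for t c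
      by (simp add: \<tau>_def space_PiM)
    have tau: "\<tau> t \<in> measurable ?N ?N" for t
      unfolding \<tau>_def
      by (intro measurable_restrict borel_measurable_add measurable_component_singleton)
        (auto simp: measurable_lborel1 measurable_lborel2)
    \<comment> \<open>Joint measurability in \<open>c\<close> and \<open>t\<close> is what the
      exchange of the two \<open>AE\<close> quantifiers below requires.\<close>
    have joint: "{x \<in> space (?N \<Otimes>\<^sub>M ?L). \<tau> (snd x) (fst x) \<notin> ?E} \<in> sets (?N \<Otimes>\<^sub>M ?L)"
    proof -
      have "{x \<in> space (?N \<Otimes>\<^sub>M ?L). \<tau> (snd x) (fst x) \<notin> ?E} =
          (\<lambda>x. \<tau> (snd x) (fst x)) -` (space ?N - ?E) \<inter> space (?N \<Otimes>\<^sub>M ?L)"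
        using tau_space by auto
      then show ?thesis
        using measurable_sets[OF tau_pair, of "space ?N - ?E"] E by auto
    qed
    have "AE c in ?N. AE t in ?L. \<tau> t c \<notin> ?E"
    proof (rule AE_I2)
      fix c assume c: "c \<in> space ?N"
      \<comment> \<open>The coordinates \<open>c\<close> are absorbed into the base point, so each
        section in \<open>t\<close> is contained in one of the sets of \<open>negl\<close>.\<close>
      have "v + ?lin c \<in> topspace X"
        using v sub by (intro subspace_add subspace_sum subspace_scale) auto
      from negl[OF this] have "negligible {t. \<tau> t c \<in> ?E}"
        by (rule negligible_subset) (auto simp: lin_tau s add.assoc)
      then have "AE t in lebesgue. \<tau> t c \<notin> ?E"
        unfolding negligible_iff_null_sets eventually_ae_filter by auto
      then show "AE t in ?L. \<tau> t c \<notin> ?E"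
        by (simp add: AE_completion_iff)
    qed
    then have "AE t in ?L. AE c in ?N. \<tau> t c \<notin> ?E"
      by (subst (asm) AE_commute[OF joint])
    \<comment> \<open>Lebesgue measure is nonzero, so an almost everywhere property holds for some
      \<open>t\<close>; a single good shift suffices.\<close>
    moreover have "\<not> (AE t in ?L. False)"
      by (simp add: AE_iff_measurable[of "UNIV"])
    ultimately obtain t where "AE c in ?N. \<tau> t c \<notin> ?E"
      by (metis (no_types, lifting) eventually_mono)
    then have distr: "AE c in distr ?N ?N (\<tau> t). c \<notin> ?E"
      by (subst AE_distr_iff[OF tau]) (use E in auto)
    have "distr ?N ?N (\<tau> t) = ?N"
      using PiM_lborel_translate[OF fin, of "s t"] by (simp add: \<tau>_def[abs_def])
    with distr have "AE c in ?N. c \<notin> ?E" by metis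
    then show ?thesis
      by (rule AE_mp) (auto intro!: AE_I2)
  qed
  moreover have "Q \<in> sigma_sets (topspace X) {W. openin X W}"
  proof -
    have "topspace X - (topspace X - Q) \<in> sigma_sets (topspace X) {W. openin X W}"
      using op by (intro sigma_sets.Compl sigma_sets.Basic) auto
    moreover have "topspace X - (topspace X - Q) = Q" using \<open>Q \<subseteq> topspace X\<close> by auto
    ultimately show ?thesis by simp
  qed
  ultimately show ?thesis
    unfolding shy_def by (intro bexI[of _ Q] conjI ballI order_refl)
qed

section \<open>Covers by small boxes and negligible parameter sets\<close>

text \<open>Vanishing \<open>k\<close>-dimensional content along finite covers by boxes of equal
  size. It passes to subsets, whereas the limit in \<open>has_box_dim\<close> need not exist for
  them.\<close>

definition small_covers :: "nat \<Rightarrow> 'a::euclidean_space set \<Rightarrow> bool" where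
  "small_covers k K \<longleftrightarrow> (\<forall>\<eta>>0. \<exists>\<epsilon> C. 0 < \<epsilon> \<and> finite C \<and>
     K \<subseteq> (\<Union>a\<in>C. cbox a (a + \<epsilon> *\<^sub>R One)) \<and> real (card C) * \<epsilon> ^ k < \<eta>)"

lemma small_covers_mono: "small_covers k K \<Longrightarrow> L \<subseteq> K \<Longrightarrow> small_covers k L"
  unfolding small_covers_def by (meson order_trans)

lemma small_covers_singleton:
  assumes "k \<ge> 1" shows "small_covers k {a}"
  unfolding small_covers_def
proof (intro allI impI)
  fix \<eta> :: real assume "\<eta> > 0"
  \<comment> \<open>\<open>\<epsilon> \<le> 1\<close> gives
    \<open>\<epsilon> ^ k \<le> \<epsilon>\<close>, and half of \<open>\<eta>\<close> makes the
    final bound strict.\<close>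
  define \<epsilon> where "\<epsilon> = min (1/2) (\<eta>/2)"
  have "0 < \<epsilon>" "\<epsilon> < \<eta>" "\<epsilon> \<le> 1" using \<open>\<eta> > 0\<close> by (auto simp: \<epsilon>_def)
  moreover have "\<epsilon> ^ k \<le> \<epsilon> ^ 1"
    using calculation assms by (intro power_decreasing) auto
  moreover have "a \<in> cbox a (a + \<epsilon> *\<^sub>R One)"
    using \<open>0 < \<epsilon>\<close> by (auto simp: mem_box inner_simps)
  ultimately show "\<exists>\<epsilon> C. 0 < \<epsilon> \<and> finite C \<and> {a} \<subseteq> (\<Union>a\<in>C. cbox a (a + \<epsilon> *\<^sub>R One))
      \<and> real (card C) * \<epsilon> ^ k < \<eta>"
    by (intro exI[of _ \<epsilon>] exI[of _ "{a}"]) auto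
qed

text \<open>Total boundedness of the closure provides some finite cover, so the \<open>LEAST\<close>
  in \<open>box_count\<close> is attained and not a default value.\<close>

lemma box_count_cover:
  fixes A :: "'a::euclidean_space set"
  assumes "bounded A" "\<epsilon> > 0"
  obtains C where "finite C" "card C = box_count A \<epsilon>" "A \<subseteq> (\<Union>a\<in>C. cbox a (a + \<epsilon> *\<^sub>R One))"
proof -
  have "compact (closure A)" using assms(1) by (simp add: compact_closure)
  then obtain D where D: "finite D" "closure A \<subseteq> (\<Union>x\<in>D. ball x (\<epsilon>/2))"
    using assms(2) unfolding compact_eq_totally_bounded by (meson half_gt_zero)
  \<comment> \<open>Boxes are given by their lower corners, balls by their centres; half the side
    converts one into the other.\<close>
  let ?sh = "\<lambda>x. x - (\<epsilon>/2) *\<^sub>R (One::'a)"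
  have "ball x (\<epsilon>/2) \<subseteq> cbox (?sh x) (?sh x + \<epsilon> *\<^sub>R One)" for x
  proof
    fix z assume z: "z \<in> ball x (\<epsilon>/2)"
    show "z \<in> cbox (?sh x) (?sh x + \<epsilon> *\<^sub>R One)"
      unfolding mem_box
    proof
      fix i :: 'a assume i: "i \<in> Basis"
      have "\<bar>(z - x) \<bullet> i\<bar> < \<epsilon>/2"
        using z Basis_le_norm[OF i, of "z - x"] by (simp add: dist_norm norm_minus_commute)
      then have "z \<bullet> i - x \<bullet> i < \<epsilon>/2" "x \<bullet> i - z \<bullet> i < \<epsilon>/2"
        unfolding inner_diff_left by linarith+
      then show "?sh x \<bullet> i \<le> z \<bullet> i \<and> z \<bullet> i \<le> (?sh x + \<epsilon> *\<^sub>R One) \<bullet> i"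
        using i by (simp add: inner_simps)
    qed
  qed
  note box = this
  have "A \<subseteq> (\<Union>a\<in>?sh ` D. cbox a (a + \<epsilon> *\<^sub>R One))"
  proof
    fix z assume "z \<in> A"
    then have "z \<in> (\<Union>x\<in>D. ball x (\<epsilon>/2))" using D(2) closure_subset by (meson subsetD)
    then obtain x where "x \<in> D" "z \<in> ball x (\<epsilon>/2)" by (rule UN_E)
    then show "z \<in> (\<Union>a\<in>?sh ` D. cbox a (a + \<epsilon> *\<^sub>R One))"
      by (intro UN_I[OF imageI] subsetD[OF box])
  qed
  then have "\<exists>k C. finite C \<and> card C = k \<and> A \<subseteq> (\<Union>a\<in>C. cbox a (a + \<epsilon> *\<^sub>R One))"
    using D(1) by (intro exI[of _ "card (?sh ` D)"] exI[of _ "?sh ` D"] conjI finite_imageI refl)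
  from LeastI_ex[OF this]
  have "\<exists>C. finite C \<and> card C = box_count A \<epsilon> \<and> A \<subseteq> (\<Union>a\<in>C. cbox a (a + \<epsilon> *\<^sub>R One))"
    by (simp only: box_count_def)
  then show ?thesis by (elim exE conjE) (rule that)
qed

text \<open>For \<open>d < q < k\<close> the number of boxes is at most
  \<open>\<epsilon> powr (- q)\<close> for small \<open>\<epsilon>\<close>, so the content is at
  most \<open>\<epsilon> powr (k - q)\<close>, which tends to 0.\<close>

lemma small_covers_if_box_dim:
  fixes A :: "'a::euclidean_space set"
  assumes "has_box_dim A d" "d < real k"
  shows "small_covers k A"
  unfolding small_covers_def
proof (intro allI impI)
  fix \<eta> :: real assume "\<eta> > 0"
  obtain q where q: "d < q" "q < real k" using assms(2) dense by blast
  have lim: "((\<lambda>\<epsilon>. ln (real (box_count A \<epsilon>)) / ln (1 / \<epsilon>)) \<longlongrightarrow> d) (at_right 0)"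
    and bd: "bounded A"
    using assms(1) unfolding has_box_dim_def by auto
  have "((\<lambda>\<epsilon>::real. \<epsilon> powr (real k - q)) \<longlongrightarrow> 0 powr (real k - q)) (at_right 0)"
    by (rule tendsto_powr2) (use q in \<open>auto intro!: tendsto_intros eventually_at_rightI[of 0 1]\<close>)
  then have "eventually (\<lambda>\<epsilon>::real. \<epsilon> powr (real k - q) < \<eta>) (at_right 0)"
    using \<open>\<eta> > 0\<close> by (auto dest: order_tendstoD(2))
  moreover have "eventually (\<lambda>\<epsilon>. ln (real (box_count A \<epsilon>)) / ln (1 / \<epsilon>) < q) (at_right 0)"
    using lim q(1) by (rule order_tendstoD(2))
  moreover have "eventually (\<lambda>\<epsilon>::real. \<epsilon> \<in> {0<..<1}) (at_right 0)"
    by (rule eventually_at_rightI[of 0 1]) auto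
  ultimately have "eventually (\<lambda>\<epsilon>::real. \<epsilon> powr (real k - q) < \<eta> \<and>
      ln (real (box_count A \<epsilon>)) / ln (1 / \<epsilon>) < q \<and> \<epsilon> \<in> {0<..<1}) (at_right 0)"
    by (intro eventually_conj)
  then obtain \<epsilon> :: real where e: "\<epsilon> powr (real k - q) < \<eta>"
      "ln (real (box_count A \<epsilon>)) / ln (1 / \<epsilon>) < q" "0 < \<epsilon>" "\<epsilon> < 1"
    by (auto dest!: eventually_happens'[OF trivial_limit_at_right_real])
  obtain C where C: "finite C" "card C = box_count A \<epsilon>" "A \<subseteq> (\<Union>a\<in>C. cbox a (a + \<epsilon> *\<^sub>R One))"
    using box_count_cover[OF bd e(3)] .
  have "real (card C) * \<epsilon> ^ k < \<eta>"
  \<comment> \<open>The logarithmic bound carries no information about a count of 0.\<close>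
  proof (cases "card C = 0")
    case True then show ?thesis using \<open>\<eta> > 0\<close> by simp
  next
    case False
    have "ln (real (card C)) < q * ln (1 / \<epsilon>)"
      using e C(2) by (simp add: divide_simps split: if_splits)
    then have "real (card C) \<le> exp (q * ln (1/\<epsilon>))"
      using False by (metis exp_ln less_imp_le exp_le_cancel_iff of_nat_0_less_iff neq0_conv)
    also have "\<dots> = \<epsilon> powr (- q)"
      using e by (simp add: powr_def ln_div)
    finally have "real (card C) * \<epsilon> ^ k \<le> \<epsilon> powr (- q) * \<epsilon> powr (real k)"
      using e by (simp add: powr_realpow mult_right_mono)
    also have "\<dots> = \<epsilon> powr (real k - q)"
      by (simp add: powr_add[symmetric])
    finally show ?thesis using e by simp
  qed
  then show "\<exists>\<epsilon> C. 0 < \<epsilon> \<and> finite C \<and> A \<subseteq> (\<Union>a\<in>C. cbox a (a + \<epsilon> *\<^sub>R One))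
      \<and> real (card C) * \<epsilon> ^ k < \<eta>"
    using e C by blast
qed

text \<open>The parameters \<open>t\<close> that \<open>P\<close> relates to points of one small box
  lie in one ball of comparable radius. Since the exponent in the cover is the dimension of the
  parameter space, these balls have small total volume.\<close>

lemma negligible_if_Lipschitz_parameter:
  fixes P :: "'b::euclidean_space \<Rightarrow> 'a::euclidean_space \<Rightarrow> bool"
  assumes cov: "small_covers DIM('b) K"
    and Lip: "\<And>t t' z z'. \<lbrakk>t \<in> S; t' \<in> S; z \<in> K; z' \<in> K; P t z; P t' z'\<rbrakk> \<Longrightarrow>
      norm (t - t') \<le> L * norm (z - z')"
  shows "negligible {t \<in> S. \<exists>z\<in>K. P t z}"
  unfolding negligible_outer
proof (intro allI impI)
  fix \<eta> :: real assume "\<eta> > 0"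
  \<comment> \<open>A box of side \<open>\<epsilon>\<close> has diameter at most
    \<open>DIM('a) * \<epsilon>\<close> by the l1 bound; \<open>max L 1\<close> keeps the radius
    positive whatever the sign of \<open>L\<close>.\<close>
  define M where "M = max L 1 * real DIM('a)"
  define V where "V = unit_ball_vol (real DIM('b)) * M ^ DIM('b)"
  have "M > 0" unfolding M_def by (auto simp: DIM_positive)
  then have "V > 0" unfolding V_def by simp
  then obtain \<epsilon> C where C: "0 < \<epsilon>" "finite C" "K \<subseteq> (\<Union>a\<in>C. cbox a (a + \<epsilon> *\<^sub>R One))"
      "real (card C) * \<epsilon> ^ DIM('b) < \<eta> / V"
    using cov \<open>\<eta> > 0\<close> unfolding small_covers_def by (meson divide_pos_pos)
  let ?piece = "\<lambda>a t. t \<in> S \<and> (\<exists>z\<in>K \<inter> cbox a (a + \<epsilon> *\<^sub>R One). P t z)"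
  \<comment> \<open>Any admissible parameter serves as the centre. For a box without one the choice
    is arbitrary, and its ball merely enlarges the cover.\<close>
  define c where "c a = (SOME t. ?piece a t)" for a
  have sub: "?piece a t \<Longrightarrow> t \<in> cball (c a) (M * \<epsilon>)" for a t
  proof -
    assume t: "?piece a t"
    then have "?piece a (c a)" unfolding c_def by (rule someI)
    with t obtain z z' where z: "z \<in> K" "z' \<in> K" "z \<in> cbox a (a + \<epsilon> *\<^sub>R One)" "z' \<in> cbox a (a + \<epsilon> *\<^sub>R One)"
        "P (c a) z" "P t z'" "t \<in> S" "c a \<in> S" by blast
    have "norm (z - z') \<le> (\<Sum>i\<in>Basis. \<bar>(z - z') \<bullet> i\<bar>)" by (rule norm_le_l1)
    also have "\<dots> \<le> (\<Sum>i\<in>(Basis::'a set). \<epsilon>)"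
      using z(3,4) by (intro sum_mono) (fastforce simp: mem_box inner_simps abs_le_iff)
    finally have nz: "norm (z - z') \<le> real DIM('a) * \<epsilon>" by simp
    have "norm (c a - t) \<le> L * norm (z - z')" using Lip z by blast
    also have "\<dots> \<le> max L 1 * norm (z - z')" by (intro mult_right_mono) auto
    also have "\<dots> \<le> max L 1 * (real DIM('a) * \<epsilon>)" using nz by (intro mult_left_mono) auto
    finally show ?thesis by (simp add: M_def dist_norm mult.assoc)
  qed
  let ?T = "\<Union>a\<in>C. cball (c a) (M * \<epsilon>)"
  have "{t \<in> S. \<exists>z\<in>K. P t z} \<subseteq> ?T"
  proof
    fix t assume "t \<in> {t \<in> S. \<exists>z\<in>K. P t z}"
    then obtain z where z: "t \<in> S" "z \<in> K" "P t z" by blast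
    with C(3) obtain a where "a \<in> C" "z \<in> cbox a (a + \<epsilon> *\<^sub>R One)" by blast
    with z sub[of t a] show "t \<in> ?T" by blast
  qed
  moreover have "?T \<in> lmeasurable"
    using C(2) by (intro fmeasurable.finite_UN) auto
  moreover have "measure lebesgue ?T < \<eta>"
  proof -
    have "measure lebesgue ?T \<le> (\<Sum>a\<in>C. measure lebesgue (cball (c a) (M * \<epsilon>)))"
      using C(2) by (intro measure_UNION_le) auto
    also have "\<dots> = real (card C) * (V * \<epsilon> ^ DIM('b))"
      using C(1) \<open>M > 0\<close> by (simp add: content_cball V_def power_mult_distrib)
    also have "\<dots> < \<eta>"
      using C(4) \<open>V > 0\<close> by (simp add: pos_less_divide_eq algebra_simps)
    finally show ?thesis .
  qed
  ultimately show "\<exists>T. {t \<in> S. \<exists>z\<in>K. P t z} \<subseteq> T \<and> T \<in> lmeasurable \<and> measure lebesgue T < \<eta>"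
    by blast
qed

text \<open>When \<open>g\<close> is close to the identity matrix, the solution \<open>t\<close> of the linear system is unique
  and depends on the parameter \<open>z\<close> in a Lipschitz way.\<close>

lemma negligible_near_identity_system:
  fixes f :: "'b::euclidean_space \<Rightarrow> 'a::euclidean_space \<Rightarrow> real" and g :: "'b \<Rightarrow> 'b \<Rightarrow> 'a \<Rightarrow> real"
  assumes cov: "small_covers DIM('b) K"
    and f: "\<And>i. i \<in> Basis \<Longrightarrow> \<exists>L. L-lipschitz_on K (f i)"
    and g: "\<And>i l. i \<in> Basis \<Longrightarrow> l \<in> Basis \<Longrightarrow> \<exists>L. L-lipschitz_on K (g i l)"
    and near: "\<And>i l z. i \<in> Basis \<Longrightarrow> l \<in> Basis \<Longrightarrow> z \<in> K \<Longrightarrow>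
      \<bar>g i l z - (if i = l then 1 else 0)\<bar> \<le> 1 / (2 * real DIM('b))"
  shows "negligible {t. \<exists>z\<in>K. \<forall>i\<in>Basis. f i z + (\<Sum>l\<in>Basis. (t \<bullet> l) * g i l z) = 0}"
proof -
  let ?k = "real DIM('b)"
  have kpos: "?k > 0" by (simp add: DIM_positive)
  obtain Lf where Lf: "\<And>i. i \<in> Basis \<Longrightarrow> (Lf i)-lipschitz_on K (f i)" using f by metis
  obtain Lg where Lg: "\<And>i l. i \<in> Basis \<Longrightarrow> l \<in> Basis \<Longrightarrow> (Lg i l)-lipschitz_on K (g i l)" using g by metis
  define L where "L = (\<Sum>i\<in>Basis. \<bar>Lf i\<bar>) + (\<Sum>i\<in>Basis. \<Sum>l\<in>Basis. \<bar>Lg i l\<bar>)"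
  have "L \<ge> 0" unfolding L_def by (intro add_nonneg_nonneg sum_nonneg) auto
  have fL: "\<bar>f i z - f i z'\<bar> \<le> L * norm (z - z')" if "i \<in> Basis" "z \<in> K" "z' \<in> K" for i z z'
  proof -
    have "\<bar>f i z - f i z'\<bar> \<le> Lf i * norm (z - z')"
      using lipschitz_onD[OF Lf[OF that(1)] that(2,3)] by (simp add: dist_norm)
    also have "Lf i \<le> (\<Sum>i\<in>Basis. \<bar>Lf i\<bar>)"
      using member_le_sum[OF that(1), of "\<lambda>i. \<bar>Lf i\<bar>"] by auto
    also have "\<dots> \<le> L" unfolding L_def by (simp add: sum_nonneg)
    finally show ?thesis by (simp add: mult_right_mono)
  qed
  have gL: "\<bar>g i l z - g i l z'\<bar> \<le> L * norm (z - z')"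
    if "i \<in> Basis" "l \<in> Basis" "z \<in> K" "z' \<in> K" for i l z z'
  proof -
    have "\<bar>g i l z - g i l z'\<bar> \<le> Lg i l * norm (z - z')"
      using lipschitz_onD[OF Lg[OF that(1,2)] that(3,4)] by (simp add: dist_norm)
    also have "Lg i l \<le> (\<Sum>l\<in>Basis. \<bar>Lg i l\<bar>)"
      using member_le_sum[OF that(2), of "\<lambda>l. \<bar>Lg i l\<bar>"] by auto
    also have "\<dots> \<le> (\<Sum>i\<in>Basis. \<Sum>l\<in>Basis. \<bar>Lg i l\<bar>)"
      using member_le_sum[OF that(1), of "\<lambda>i. \<Sum>l\<in>Basis. \<bar>Lg i l\<bar>"] by (auto intro: sum_nonneg)
    also have "\<dots> \<le> L" unfolding L_def by (simp add: sum_nonneg)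
    finally show ?thesis by (simp add: mult_right_mono)
  qed
  let ?P = "\<lambda>t z. \<forall>i\<in>Basis. f i z + (\<Sum>l\<in>Basis. (t \<bullet> l) * g i l z) = 0"
  \<comment> \<open>The Lipschitz constant grows with the size of the parameter, because
    \<open>t'\<close> multiplies the variation of \<open>g\<close>; hence balls of radius
    \<open>R\<close> first and a countable union afterwards.\<close>
  have "negligible {t \<in> cball 0 (real R). \<exists>z\<in>K. ?P t z}" for R :: nat
  proof (rule negligible_if_Lipschitz_parameter[OF cov, where L = "2 * ?k * (L + ?k * real R * L)"])
    fix t t' :: 'b and z z' assume tz: "t \<in> cball 0 (real R)" "t' \<in> cball 0 (real R)" "z \<in> K" "z' \<in> K"
      "?P t z" "?P t' z'"
    define w where "w = t - t'"
    define s where "s = (\<Sum>l\<in>Basis. \<bar>w \<bullet> l\<bar>)"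
    have wl: "\<bar>w \<bullet> i\<bar> \<le> s / (2 * ?k) + (L + ?k * real R * L) * norm (z - z')" if i: "i \<in> Basis" for i
    proof -
      \<comment> \<open>Subtracting the equations at \<open>z\<close> and \<open>z'\<close> and
        comparing \<open>g\<close> at \<open>z\<close> with the identity matrix isolates
        \<open>w\<close>.\<close>
      have "w \<bullet> i = (\<Sum>l\<in>Basis. (w \<bullet> l) * (if i = l then 1 else 0))"
        using i by (simp add: if_distrib cong: if_cong)
      also have "\<dots> = (\<Sum>l\<in>Basis. (t \<bullet> l) * g i l z) - (\<Sum>l\<in>Basis. (t' \<bullet> l) * g i l z')
          + (\<Sum>l\<in>Basis. (w \<bullet> l) * ((if i = l then 1 else 0) - g i l z))
          + (\<Sum>l\<in>Basis. (t' \<bullet> l) * (g i l z' - g i l z))"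
        unfolding sum.distrib[symmetric] sum_subtractf[symmetric]
        by (intro sum.cong refl) (simp add: w_def inner_diff_left algebra_simps)
      also have "(\<Sum>l\<in>Basis. (t \<bullet> l) * g i l z) = - f i z" using tz(5) i by (auto simp: eq_neg_iff_add_eq_0 add.commute)
      also have "(\<Sum>l\<in>Basis. (t' \<bullet> l) * g i l z') = - f i z'" using tz(6) i by (auto simp: eq_neg_iff_add_eq_0 add.commute)
      finally have eq: "w \<bullet> i = (f i z' - f i z)
          + (\<Sum>l\<in>Basis. (w \<bullet> l) * ((if i = l then 1 else 0) - g i l z))
          + (\<Sum>l\<in>Basis. (t' \<bullet> l) * (g i l z' - g i l z))" by simp
      have b1: "\<bar>f i z' - f i z\<bar> \<le> L * norm (z - z')"
        using fL[OF i tz(4,3)] by (simp add: norm_minus_commute)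
      have "\<bar>(w \<bullet> l) * ((if i = l then 1 else 0) - g i l z)\<bar> \<le> \<bar>w \<bullet> l\<bar> * (1 / (2 * ?k))"
        if l: "l \<in> Basis" for l
        using near[OF i l tz(3)] unfolding abs_mult abs_minus_commute[of "g i l z"]
        by (intro mult_left_mono abs_ge_zero)
      then have "\<bar>\<Sum>l\<in>Basis. (w \<bullet> l) * ((if i = l then 1 else 0) - g i l z)\<bar>
          \<le> (\<Sum>l\<in>Basis. \<bar>w \<bullet> l\<bar> * (1 / (2 * ?k)))"
        by (intro order_trans[OF sum_abs] sum_mono)
      then have b2: "\<bar>\<Sum>l\<in>Basis. (w \<bullet> l) * ((if i = l then 1 else 0) - g i l z)\<bar> \<le> s / (2 * ?k)"
        by (simp add: s_def sum_divide_distrib)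
      have "\<bar>(t' \<bullet> l) * (g i l z' - g i l z)\<bar> \<le> real R * (L * norm (z - z'))" if l: "l \<in> Basis" for l
      proof -
        have "\<bar>t' \<bullet> l\<bar> \<le> real R"
          using Basis_le_norm[OF l, of t'] tz(2) by (simp add: dist_norm)
        then show ?thesis
          using gL[OF i l tz(4,3)] unfolding abs_mult by (intro mult_mono) (auto simp: norm_minus_commute)
      qed
      then have "\<bar>\<Sum>l\<in>Basis. (t' \<bullet> l) * (g i l z' - g i l z)\<bar> \<le> (\<Sum>l\<in>(Basis::'b set). real R * (L * norm (z - z')))"
        by (intro order_trans[OF sum_abs] sum_mono)
      then have b3: "\<bar>\<Sum>l\<in>Basis. (t' \<bullet> l) * (g i l z' - g i l z)\<bar> \<le> ?k * (real R * (L * norm (z - z')))"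
        by simp
      have "\<bar>w \<bullet> i\<bar> \<le> L * norm (z - z') + s / (2 * ?k) + ?k * (real R * (L * norm (z - z')))"
        unfolding eq using b1 b2 b3 by linarith
      then show ?thesis by (simp add: algebra_simps)
    qed
    \<comment> \<open>Summed over \<open>i\<close>, the deviation from the identity contributes only
      \<open>s / 2\<close>, which is absorbed on the left.\<close>
    have "s \<le> (\<Sum>i\<in>(Basis::'b set). s / (2 * ?k) + (L + ?k * real R * L) * norm (z - z'))"
      unfolding s_def[of] using wl unfolding s_def by (intro sum_mono) auto
    also have "\<dots> = s / 2 + ?k * ((L + ?k * real R * L) * norm (z - z'))"
      using kpos by (simp add: field_simps)
    finally have "s \<le> 2 * ?k * (L + ?k * real R * L) * norm (z - z')"
      by simp
    moreover have "norm w \<le> s" unfolding s_def by (rule norm_le_l1)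
    ultimately show "norm (t - t') \<le> 2 * ?k * (L + ?k * real R * L) * norm (z - z')"
      unfolding w_def by linarith
  qed
  then have "negligible (\<Union>R::nat. {t \<in> cball 0 (real R). \<exists>z\<in>K. ?P t z})"
    by (intro negligible_countable_Union) auto
  moreover have "{t. \<exists>z\<in>K. ?P t z} \<subseteq> (\<Union>R::nat. {t \<in> cball 0 (real R). \<exists>z\<in>K. ?P t z})"
  proof
    fix t assume "t \<in> {t. \<exists>z\<in>K. ?P t z}"
    moreover obtain R :: nat where "norm t \<le> real R" using real_arch_simple by blast
    ultimately show "t \<in> (\<Union>R::nat. {t \<in> cball 0 (real R). \<exists>z\<in>K. ?P t z})" by auto
  qed
  ultimately show ?thesis by (rule negligible_subset)
qed

section \<open>Maps of class C1 and the polynomial probe\<close>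

lemma C1_on_imp_continuous_on: "C1_on U f \<Longrightarrow> continuous_on U f"
  unfolding C1_on_def
  by (meson has_derivative_continuous continuous_at_imp_continuous_on)

lemma C1_on_id: "C1_on U (\<lambda>x. x)"
  unfolding C1_on_def by (intro exI[of _ "\<lambda>_. id_blinfun"]) (auto intro!: derivative_eq_intros)

lemma C1_on_const: "C1_on U (\<lambda>x. c)"
  unfolding C1_on_def by (intro exI[of _ "\<lambda>_. 0"]) (auto simp: zero_blinfun.rep_eq)

lemma C1_on_compose:
  assumes "C1_on U f" "C1_on U S" "S ` U \<subseteq> U"
  shows "C1_on U (\<lambda>x. f (S x))"
proof -
  obtain f' where f': "\<And>x. x \<in> U \<Longrightarrow> (f has_derivative blinfun_apply (f' x)) (at x)" "continuous_on U f'"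
    using assms(1) unfolding C1_on_def by auto
  obtain S' where S': "\<And>x. x \<in> U \<Longrightarrow> (S has_derivative blinfun_apply (S' x)) (at x)" "continuous_on U S'"
    using assms(2) unfolding C1_on_def by auto
  have "continuous_on U (\<lambda>x. f' (S x) o\<^sub>L S' x)"
    using f'(2) S'(2) C1_on_imp_continuous_on[OF assms(2)] assms(3)
    by (intro continuous_intros continuous_on_compose2[OF f'(2)]) auto
  moreover have "((\<lambda>x. f (S x)) has_derivative blinfun_apply (f' (S x) o\<^sub>L S' x)) (at x)" if "x \<in> U" for x
  proof -
    have "blinfun_apply (f' (S x) o\<^sub>L S' x) = (\<lambda>y. f' (S x) (S' x y))" by auto
    then show ?thesis
      using has_derivative_compose[OF S'(1)[OF that] f'(1)[of "S x"]] that assms(3) by auto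
  qed
  ultimately show ?thesis
    unfolding C1_on_def by (intro exI[of _ "\<lambda>x. f' (S x) o\<^sub>L S' x"] conjI ballI)
qed

lemma C1_on_bounded_linear:
  assumes "bounded_linear L" "C1_on U f"
  shows "C1_on U (\<lambda>x. L (f x))"
proof -
  obtain f' where f': "\<And>x. x \<in> U \<Longrightarrow> (f has_derivative blinfun_apply (f' x)) (at x)" "continuous_on U f'"
    using assms(2) unfolding C1_on_def by auto
  have "((\<lambda>x. L (f x)) has_derivative blinfun_apply (Blinfun L o\<^sub>L f' x)) (at x)" if "x \<in> U" for x
  proof -
    have "blinfun_apply (Blinfun L o\<^sub>L f' x) = (\<lambda>y. L (f' x y))"
      by (auto simp: bounded_linear_Blinfun_apply[OF assms(1)])
    then show ?thesis
      using bounded_linear.has_derivative[OF assms(1) f'(1)[OF that]] by simp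
  qed
  moreover have "continuous_on U (\<lambda>x. Blinfun L o\<^sub>L f' x)"
    by (intro continuous_intros f'(2))
  ultimately show ?thesis
    unfolding C1_on_def by (intro exI[of _ "\<lambda>x. Blinfun L o\<^sub>L f' x"] conjI ballI)
qed

lemma C1_on_diff:
  assumes "C1_on U f" "C1_on U g"
  shows "C1_on U (\<lambda>x. f x - g x)"
proof -
  obtain f' where f': "\<And>x. x \<in> U \<Longrightarrow> (f has_derivative blinfun_apply (f' x)) (at x)" "continuous_on U f'"
    using assms(1) unfolding C1_on_def by auto
  obtain g' where g': "\<And>x. x \<in> U \<Longrightarrow> (g has_derivative blinfun_apply (g' x)) (at x)" "continuous_on U g'"
    using assms(2) unfolding C1_on_def by auto
  show ?thesis
    unfolding C1_on_def using f' g'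
    by (intro exI[of _ "\<lambda>x. f' x - g' x"])
      (auto simp: minus_blinfun.rep_eq intro!: derivative_intros continuous_intros)
qed

lemma C1_on_mult_inner:
  assumes "C1_on U f"
  shows "C1_on U (\<lambda>x. f x * (x \<bullet> e))"
proof -
  obtain f' where f': "\<And>x. x \<in> U \<Longrightarrow> (f has_derivative blinfun_apply (f' x)) (at x)" "continuous_on U f'"
    using assms(1) unfolding C1_on_def by auto
  show ?thesis
    unfolding C1_on_def using f' C1_on_imp_continuous_on[OF assms]
    by (intro exI[of _ "\<lambda>x. f x *\<^sub>R blinfun_inner_left e + (x \<bullet> e) *\<^sub>R f' x"])
      (auto simp: plus_blinfun.rep_eq scaleR_blinfun.rep_eq inner_commute
        intro!: derivative_eq_intros continuous_intros)
qed

text \<open>The derivative is bounded on \<open>K\<close> by compactness, and convexity permits the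
  mean value inequality; for this reason later sets are placed inside closed balls.\<close>

lemma C1_on_imp_Lipschitz_on:
  assumes "C1_on U f" "compact K" "convex K" "K \<subseteq> U"
  shows "\<exists>L. L-lipschitz_on K f"
proof -
  obtain f' where f': "\<And>x. x \<in> U \<Longrightarrow> (f has_derivative blinfun_apply (f' x)) (at x)" "continuous_on U f'"
    using assms(1) unfolding C1_on_def by auto
  have "compact (f' ` K)"
    using assms f' by (meson compact_continuous_image continuous_on_subset)
  then obtain L where L: "L > 0" "\<forall>x\<in>f' ` K. norm x \<le> L"
    using compact_imp_bounded bounded_pos by metis
  have "L-lipschitz_on K f"
  proof (rule lipschitz_onI)
    fix x y assume "x \<in> K" "y \<in> K"
    then show "dist (f x) (f y) \<le> L * dist x y"
      unfolding dist_norm using assms f'(1) L(2)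
      by (intro differentiable_bound[of K f "\<lambda>x. blinfun_apply (f' x)"])
        (auto simp: norm_blinfun.rep_eq[symmetric] intro: has_derivative_at_withinI)
  qed (use L in auto)
  then show ?thesis ..
qed

lemma funpow_in:
  assumes "S ` U \<subseteq> U" "x \<in> U" shows "(S ^^ i) x \<in> U"
  using assms by (induction i) auto

lemma C1_on_funpow:
  assumes "C1_on U f" "C1_on U S" "S ` U \<subseteq> U"
  shows "C1_on U (\<lambda>x. f ((S ^^ i) x))"
proof (induction i)
  case (Suc i)
  from C1_on_compose[OF this assms(2,3)] show ?case
    by (simp only: funpow_Suc_right o_apply)
qed (use assms in auto)

lemma C1_on_nth: "C1_on U Y \<Longrightarrow> C1_on U (\<lambda>x. Y x $ j)"
  by (rule C1_on_bounded_linear[OF bounded_linear_vec_nth])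

section \<open>Polynomial interpolation and the probe space\<close>

fun monomials :: "nat \<Rightarrow> ('a::euclidean_space \<Rightarrow> real) set" where
  "monomials 0 = {\<lambda>_. 1}"
| "monomials (Suc k) = (\<Union>f\<in>monomials k. insert f ((\<lambda>e x. f x * (x \<bullet> e)) ` Basis))"

lemma finite_monomials: "finite (monomials k)"
  by (induction k) auto

lemma C1_on_monomials: "f \<in> monomials k \<Longrightarrow> C1_on U f"
  by (induction k arbitrary: f) (auto intro: C1_on_const C1_on_mult_inner)

lemma C1_on_span:
  assumes "f \<in> span F" "\<And>g. g \<in> F \<Longrightarrow> C1_on U (g :: 'a::euclidean_space \<Rightarrow> 'b::euclidean_space)"
  shows "C1_on U f"
  using assms(1)
proof (induction rule: span_induct_alt)
  case base
  then show ?case using C1_on_const[of U 0] by (simp add: zero_fun_def)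
next
  case (step c x y)
  have "C1_on U (\<lambda>z. c *\<^sub>R x z)"
    using assms(2)[OF step(1)] by (rule C1_on_bounded_linear[OF bounded_linear_scaleR_right])
  moreover have "C1_on U (\<lambda>z. - y z)"
    using step(2) by (rule C1_on_bounded_linear[OF bounded_linear_minus[OF bounded_linear_ident]])
  ultimately have "C1_on U (\<lambda>z. c *\<^sub>R x z - - y z)" by (rule C1_on_diff)
  then show ?case by (simp add: plus_fun_def scaleR_fun_def)
qed

lemma span_monomials_mult_inner:
  assumes "f \<in> span (monomials k)" "e \<in> Basis"
  shows "(\<lambda>x. f x * (x \<bullet> e)) \<in> span (monomials (Suc k))"
  using assms(1)
proof (induction rule: span_induct_alt)
  case base
  then show ?case by (simp add: zero_fun_def[symmetric] span_zero)
next
  case (step c g h)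
  have "(\<lambda>x. g x * (x \<bullet> e)) \<in> monomials (Suc k)"
    using step(1) assms(2) by auto
  then have "c *\<^sub>R (\<lambda>x. g x * (x \<bullet> e)) + (\<lambda>x. h x * (x \<bullet> e)) \<in> span (monomials (Suc k))"
    using step(2) by (intro span_add span_scale) (auto intro: span_base)
  also have "c *\<^sub>R (\<lambda>x. g x * (x \<bullet> e)) + (\<lambda>x. h x * (x \<bullet> e)) = (\<lambda>x. (c *\<^sub>R g + h) x * (x \<bullet> e))"
    by (auto simp: fun_eq_iff scaleR_fun_def algebra_simps)
  finally show ?case .
qed

lemma span_monomials_Suc: "span (monomials k) \<subseteq> span (monomials (Suc k))"
  by (intro span_mono) auto

text \<open>Each node \<open>u\<close> of \<open>W\<close> costs one degree: it is handled by
  multiplying with an affine function that vanishes at \<open>u\<close> and equals 1 at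
  \<open>w\<close>.\<close>

lemma polynomial_interpolation:
  fixes w :: "'a::euclidean_space"
  assumes "finite W" "w \<notin> W" "card W \<le> k"
  shows "\<exists>g\<in>span (monomials k). g w = 1 \<and> (\<forall>u\<in>W. g u = 0)"
  using assms
proof (induction k arbitrary: W)
  case 0
  then show ?case by (intro bexI[of _ "\<lambda>_. 1"]) (auto intro: span_base)
next
  case (Suc k)
  show ?case
  proof (cases "W = {}")
    case True
    then obtain g where "g \<in> span (monomials k)" "g w = 1" using Suc.IH[of "{}"] by auto
    then show ?thesis using True span_monomials_Suc by blast
  next
    case False
    then obtain u where u: "u \<in> W" by auto
    have "card (W - {u}) \<le> k" using Suc.prems u by simp
    then obtain g where g: "g \<in> span (monomials k)" "g w = 1" "\<forall>v\<in>W - {u}. g v = 0"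
      using Suc.IH[of "W - {u}"] Suc.prems by auto
    define a where "a = (w - u) /\<^sub>R (norm (w - u))\<^sup>2"
    \<comment> \<open>The product of \<open>g\<close> and \<open>(x - u) \<bullet> a\<close>,
      expanded into coordinates so that membership in the span is visible.\<close>
    define h where "h = (\<Sum>e\<in>Basis. (a \<bullet> e) *\<^sub>R (\<lambda>x. g x * (x \<bullet> e))) - (u \<bullet> a) *\<^sub>R g"
    have h: "h x = g x * ((x - u) \<bullet> a)" for x
    proof -
      have "h x = g x * (\<Sum>e\<in>Basis. (x \<bullet> e) * (a \<bullet> e)) - (u \<bullet> a) * g x"
        by (simp add: h_def sum_fun_apply scaleR_fun_def sum_distrib_left mult_ac)
      also have "\<dots> = g x * ((x - u) \<bullet> a)"
        by (subst euclidean_inner[symmetric]) (simp add: inner_diff_left algebra_simps)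
      finally show ?thesis .
    qed
    have "h \<in> span (monomials (Suc k))"
      unfolding h_def using g(1) span_monomials_Suc
      by (intro span_diff span_sum span_scale span_monomials_mult_inner) auto
    moreover have "h w = 1"
    proof -
      have "(w - u) \<bullet> (w - u) \<noteq> 0" using Suc.prems u by auto
      then show ?thesis using g(2) by (simp add: h a_def power2_norm_eq_inner)
    qed
    moreover have "\<forall>v\<in>W. h v = 0" using g(3) by (auto simp: h)
    ultimately show ?thesis by blast
  qed
qed

text \<open>The cut-off outside \<open>U\<close> matches the normalisation in
  \<open>C1_space\<close>; derivatives at points of the open set \<open>U\<close> are
  unaffected.\<close>

definition component_ext :: "'a set \<Rightarrow> 'm::finite \<Rightarrow> ('a \<Rightarrow> real) \<Rightarrow> 'a \<Rightarrow> real^'m" where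
  "component_ext U j g = (\<lambda>x. if x \<in> U then axis j (g x) else 0)"

lemma component_ext_C1_space:
  fixes j :: "'m::finite"
  assumes "open U" "C1_on U g"
  shows "component_ext U j g \<in> C1_space U"
proof -
  have "C1_on U (\<lambda>x. axis j (g x))"
  proof -
    have "bounded_linear (axis j :: real \<Rightarrow> real^'m)"
      unfolding linear_conv_bounded_linear[symmetric] by (auto simp: linear_iff axis_def vec_eq_iff)
    from C1_on_bounded_linear[OF this assms(2)] show ?thesis .
  qed
  then obtain f' where f': "\<And>x. x \<in> U \<Longrightarrow> ((\<lambda>x. axis j (g x)) has_derivative blinfun_apply (f' x)) (at x)"
      "continuous_on U f'"
    unfolding C1_on_def by auto
  have "(component_ext U j g has_derivative blinfun_apply (f' x)) (at x)" if "x \<in> U" for x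
    by (rule has_derivative_transform_within_open[OF f'(1)[OF that] assms(1) that])
      (simp add: component_ext_def)
  then show ?thesis
    using f'(2) unfolding C1_space_def C1_on_def by (auto simp: component_ext_def)
qed

lemma component_ext_span:
  assumes "g \<in> span F" "component_ext U j ` F \<subseteq> span B"
  shows "component_ext U j g \<in> span B"
  using assms(1)
proof (induction rule: span_induct_alt)
  case base
  have "component_ext U j 0 = 0" by (auto simp: component_ext_def fun_eq_iff axis_def vec_eq_iff)
  then show ?case by (metis span_zero)
next
  case (step c f h)
  have "component_ext U j (c *\<^sub>R f + h) = c *\<^sub>R component_ext U j f + component_ext U j h"
    by (auto simp: component_ext_def fun_eq_iff axis_def vec_eq_iff scaleR_fun_def)
  then show ?case
    using step assms(2) by (simp only:) (intro span_add span_scale; blast)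
qed

text \<open>The extended monomials may be dependent, for instance all zero when \<open>U\<close> is
  empty, while \<open>prevalent\<close> asks for a basis; a maximal independent subset keeps the
  span.\<close>

lemma polynomial_probe_exists:
  fixes U :: "'a::euclidean_space set"
  assumes "open U"
  obtains B :: "('a \<Rightarrow> real^'m) set" where "finite B" "independent B" "B \<subseteq> C1_space U"
    "\<And>g j. g \<in> span (monomials N) \<Longrightarrow> component_ext U j g \<in> span B"
proof -
  let ?G = "\<Union>j::'m. component_ext U j ` monomials N"
  obtain B where B: "B \<subseteq> ?G" "independent B" "?G \<subseteq> span B"
    using maximal_independent_subset by blast
  show ?thesis
  proof (rule that)
    have "finite ?G" by (simp add: finite_monomials)
    with B(1) show "finite B" by (rule finite_subset)
    have "?G \<subseteq> C1_space U"
      using assms by (auto intro!: component_ext_C1_space C1_on_monomials)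
    with B(1) show "B \<subseteq> C1_space U" by (rule subset_trans)
    show "component_ext U j g \<in> span B" if "g \<in> span (monomials N)" for g and j :: 'm
    proof (rule component_ext_span[OF that])
      show "component_ext U j ` monomials N \<subseteq> span B"
        using UN_upper[of j UNIV] B(3) by (rule subset_trans) simp
    qed
  qed (rule B(2))
qed

text \<open>The base sets \<open>C1_nbhd\<close> bound values as well as derivatives, so openness
  for uniform convergence of the values on compact sets is enough.\<close>

lemma openin_C1_topology_if_uniform_nbhd:
  assumes "Q \<subseteq> C1_space U"
    and "\<And>Y. Y \<in> Q \<Longrightarrow> \<exists>K \<epsilon>. compact K \<and> K \<subseteq> U \<and> \<epsilon> > 0 \<and>
      (\<forall>Z\<in>C1_space U. (\<forall>x\<in>K. norm (Z x - Y x) < \<epsilon>) \<longrightarrow> Z \<in> Q)"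
  shows "openin (C1_topology U) Q"
proof (subst openin_subopen, intro ballI)
  fix Y assume Y: "Y \<in> Q"
  then obtain K \<epsilon> where K: "compact K" "K \<subseteq> U" "\<epsilon> > 0"
    "\<And>Z. Z\<in>C1_space U \<Longrightarrow> (\<And>x. x\<in>K \<Longrightarrow> norm (Z x - Y x) < \<epsilon>) \<Longrightarrow> Z \<in> Q"
    using assms(2) by meson
  have Y1: "Y \<in> C1_space U" using Y assms(1) by auto
  have "openin (C1_topology U) (C1_nbhd U Y K \<epsilon>)"
    unfolding C1_topology_def using Y1 K(1-3) by (intro topology_generated_by_Basis) blast
  moreover have "Y \<in> C1_nbhd U Y K \<epsilon>" using Y1 K(3) by (simp add: C1_nbhd_def)
  moreover have "C1_nbhd U Y K \<epsilon> \<subseteq> Q" using K(4) by (auto simp: C1_nbhd_def)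
  ultimately show "\<exists>T. openin (C1_topology U) T \<and> Y \<in> T \<and> T \<subseteq> Q" by blast
qed

text \<open>The quantifier over an uncountable \<open>K\<close> is made countable: by compactness a
  nonnegative continuous function has a zero on \<open>K\<close> exactly when it gets below every
  \<open>1 / Suc n\<close> on a countable dense subset.\<close>

lemma sets_ex_zero:
  fixes \<Phi> :: "'c \<Rightarrow> 'a::euclidean_space \<Rightarrow> real"
  assumes "compact K"
    and cont: "\<And>c. c \<in> space N \<Longrightarrow> continuous_on K (\<Phi> c)"
    and meas: "\<And>z. z \<in> K \<Longrightarrow> (\<lambda>c. \<Phi> c z) \<in> borel_measurable N"
    and nonneg: "\<And>c z. \<Phi> c z \<ge> 0"
  shows "{c \<in> space N. \<exists>z\<in>K. \<Phi> c z = 0} \<in> sets N"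
proof -
  obtain D where D: "countable D" "D \<subseteq> K" "K \<subseteq> closure D" by (rule separable)
  have "(\<exists>z\<in>K. \<Phi> c z = 0) \<longleftrightarrow> (\<forall>n::nat. \<exists>z\<in>D. \<Phi> c z < 1 / real (Suc n))" if c: "c \<in> space N" for c
  proof
    assume "\<exists>z\<in>K. \<Phi> c z = 0"
    then obtain z where z: "z \<in> K" "\<Phi> c z = 0" by blast
    show "\<forall>n::nat. \<exists>z\<in>D. \<Phi> c z < 1 / real (Suc n)"
    proof
      fix n :: nat
      obtain d where d: "d > 0" "\<And>x. x \<in> K \<Longrightarrow> dist x z < d \<Longrightarrow> dist (\<Phi> c x) (\<Phi> c z) < 1 / real (Suc n)"
        using cont[OF c] z(1) unfolding continuous_on_iff
        by (metis of_nat_0_less_iff zero_less_Suc zero_less_divide_1_iff)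
      obtain x where "x \<in> D" "dist x z < d"
        using D(3) z(1) d(1) unfolding closure_approachable subset_iff by blast
      then show "\<exists>z\<in>D. \<Phi> c z < 1 / real (Suc n)"
        using d(2)[of x] D(2) z(2) by (intro bexI[of _ x]) (auto simp: dist_real_def simp del: of_nat_Suc)
    qed
  next
    assume *: "\<forall>n::nat. \<exists>z\<in>D. \<Phi> c z < 1 / real (Suc n)"
    then have "K \<noteq> {}" using D(2) by blast
    then obtain z where z: "z \<in> K" "\<And>x. x \<in> K \<Longrightarrow> \<Phi> c z \<le> \<Phi> c x"
      using continuous_attains_inf[OF assms(1) _ cont[OF c]] by blast
    have "\<Phi> c z \<le> 0"
    proof (rule ccontr)
      assume "\<not> \<Phi> c z \<le> 0"
      then obtain n where "1 / real (Suc n) < \<Phi> c z"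
        by (metis nat_approx_posE not_le)
      then show False using * z(2) D(2) by (meson less_le_not_le order_trans less_imp_le subsetD)
    qed
    then show "\<exists>z\<in>K. \<Phi> c z = 0" using z(1) nonneg[of c z] by (intro bexI[of _ z]) auto
  qed
  then have "{c \<in> space N. \<exists>z\<in>K. \<Phi> c z = 0} =
      {c \<in> space N. \<forall>n::nat. \<exists>z\<in>D. \<Phi> c z < 1 / real (Suc n)}" by blast
  also have "\<dots> \<in> sets N"
    by (intro sets.sets_Collect_countable_All sets.sets_Collect_countable_Ex'
        borel_measurable_less borel_measurable_const meas) (use D in auto)
  finally show ?thesis .
qed

section \<open>Coincidences of delay vectors\<close>

text \<open>One component \<open>j\<close> is tested because the delay measures are equated one
  component at a time. As \<open>p\<close> is fixed and only \<open>z\<close> varies,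
  \<open>k\<close> equations have to beat the dimension of \<open>K\<close>, not that of
  \<open>K \<times> K\<close>.\<close>

definition coincide ::
    "'a::euclidean_space set \<Rightarrow> ('a \<Rightarrow> 'a) \<Rightarrow> 'm \<Rightarrow> nat \<Rightarrow> 'a \<Rightarrow> 'a set \<Rightarrow> ('a \<Rightarrow> real^'m::finite) set" where
  "coincide U S j k p K =
     {Y \<in> C1_space U. \<exists>z\<in>K. \<forall>i<k. Y ((S ^^ i) z) $ j = Y ((S ^^ i) p) $ j}"

text \<open>The l1 distance of delay vectors turns a coincidence into a zero of a continuous
  function, accessible to minimum arguments on compact sets.\<close>

definition delay_gap ::
    "('a \<Rightarrow> 'a) \<Rightarrow> 'm \<Rightarrow> nat \<Rightarrow> 'a \<Rightarrow> ('a \<Rightarrow> real^'m::finite) \<Rightarrow> 'a \<Rightarrow> real" where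
  "delay_gap S j k p Y z = (\<Sum>i<k. \<bar>Y ((S ^^ i) z) $ j - Y ((S ^^ i) p) $ j\<bar>)"

lemma delay_gap_nonneg: "delay_gap S j k p Y z \<ge> 0"
  unfolding delay_gap_def by (simp add: sum_nonneg)

lemma delay_gap_eq_0_iff: "delay_gap S j k p Y z = 0 \<longleftrightarrow> (\<forall>i<k. Y ((S ^^ i) z) $ j = Y ((S ^^ i) p) $ j)"
  unfolding delay_gap_def by (subst sum_nonneg_eq_0_iff) auto

lemma coincide_eq_gap: "coincide U S j k p K = {Y \<in> C1_space U. \<exists>z\<in>K. delay_gap S j k p Y z = 0}"
  unfolding coincide_def delay_gap_eq_0_iff ..

lemma continuous_on_delay_gap:
  assumes "Y \<in> C1_space U" "C1_on U S" "S ` U \<subseteq> U" "K \<subseteq> U"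
  shows "continuous_on K (delay_gap S j k p Y)"
proof -
  have "C1_on U (\<lambda>z. Y ((S ^^ i) z) $ j)" for i
    using assms(1) by (intro C1_on_funpow[OF C1_on_nth assms(2,3)]) (simp add: C1_space_def)
  then have cont: "continuous_on K (\<lambda>z. Y ((S ^^ i) z) $ j)" for i
    using C1_on_imp_continuous_on continuous_on_subset assms(4) by blast
  show ?thesis
    unfolding delay_gap_def[abs_def]
    by (intro continuous_on_sum continuous_on_rabs continuous_on_diff continuous_on_const cont)
qed

text \<open>Without coincidence the gap has a positive minimum on a nonempty compact
  \<open>K\<close>, and small uniform changes of \<open>Y\<close> on the first \<open>k\<close>
  iterates of \<open>insert p K\<close> cannot close it.\<close>

lemma openin_Compl_coincide:
  assumes S: "C1_on U S" "S ` U \<subseteq> U" and K: "compact K" "K \<subseteq> U" and p: "p \<in> U"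
  shows "openin (C1_topology U) (C1_space U - coincide U S j k p K)"
proof (rule openin_C1_topology_if_uniform_nbhd)
  fix Y assume Y: "Y \<in> C1_space U - coincide U S j k p K"
  show "\<exists>K' \<epsilon>. compact K' \<and> K' \<subseteq> U \<and> \<epsilon> > 0 \<and>
      (\<forall>Z\<in>C1_space U. (\<forall>x\<in>K'. norm (Z x - Y x) < \<epsilon>) \<longrightarrow> Z \<in> C1_space U - coincide U S j k p K)"
  proof (cases "K = {}")
    case True
    then show ?thesis by (intro exI[of _ "{}"] exI[of _ 1]) (auto simp: coincide_def)
  next
    case False
    have cont: "continuous_on K (delay_gap S j k p Y)"
      using Y S K by (intro continuous_on_delay_gap) auto
    obtain z0 where z0: "z0 \<in> K" "\<And>z. z \<in> K \<Longrightarrow> delay_gap S j k p Y z0 \<le> delay_gap S j k p Y z"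
      using continuous_attains_inf[OF K(1) False cont] by blast
    define \<delta> where "\<delta> = delay_gap S j k p Y z0"
    have "\<delta> > 0"
      using Y z0(1) delay_gap_nonneg[of S j k p Y z0] unfolding \<delta>_def coincide_eq_gap by force
    \<comment> \<open>Values of \<open>Y\<close> moved by less than \<open>\<epsilon>\<close> can
      close a gap of at most \<open>2 * k * \<epsilon>\<close>, which is below
      \<open>\<delta>\<close>; the added 1 covers \<open>k = 0\<close>.\<close>
    define \<epsilon> where "\<epsilon> = \<delta> / (2 * real k + 1)"
    have "\<epsilon> > 0" using \<open>\<delta> > 0\<close> unfolding \<epsilon>_def by simp
    define K' where "K' = (\<Union>i<k. (S ^^ i) ` insert p K)"
    have "compact K'"
      unfolding K'_def
    proof (intro compact_UN compact_continuous_image compact_insert K finite_lessThan)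
      fix i
      have "C1_on U (\<lambda>x. (S ^^ i) x)" using C1_on_funpow[OF C1_on_id S] .
      then show "continuous_on (insert p K) (S ^^ i)"
        using C1_on_imp_continuous_on continuous_on_subset K(2) p by (metis insert_subset)
    qed
    moreover have "K' \<subseteq> U"
      unfolding K'_def using funpow_in[OF S(2)] K(2) p by blast
    moreover have "Z \<notin> coincide U S j k p K" if Z: "\<forall>x\<in>K'. norm (Z x - Y x) < \<epsilon>" for Z
    proof
      assume "Z \<in> coincide U S j k p K"
      then obtain z where z: "z \<in> K" "\<And>i. i < k \<Longrightarrow> Z ((S ^^ i) z) $ j = Z ((S ^^ i) p) $ j"
        unfolding coincide_def by auto
      have close: "\<bar>Z x $ j - Y x $ j\<bar> < \<epsilon>" if "x \<in> K'" for x
        using Z that component_le_norm_cart[of "Z x - Y x" j] by force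
      have "delay_gap S j k p Y z \<le> (\<Sum>i<k. 2 * \<epsilon>)"
        unfolding delay_gap_def
      proof (rule sum_mono)
        fix i assume i: "i \<in> {..<k}"
        then have "(S ^^ i) z \<in> K'" "(S ^^ i) p \<in> K'" using z(1) by (auto simp: K'_def)
        then show "\<bar>Y ((S ^^ i) z) $ j - Y ((S ^^ i) p) $ j\<bar> \<le> 2 * \<epsilon>"
          using close[of "(S ^^ i) z"] close[of "(S ^^ i) p"] z(2)[of i] i by auto
      qed
      also have "\<dots> = 2 * real k * \<epsilon>" by simp
      also have "\<dots> < \<delta>" using \<open>\<delta> > 0\<close> by (simp add: \<epsilon>_def field_simps)
      finally show False using z0(2)[OF z(1)] by (simp add: \<delta>_def)
    qed
    ultimately show ?thesis using \<open>\<epsilon> > 0\<close> by blast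
  qed
qed auto

text \<open>Evaluation at a point is affine in the coefficients \<open>c\<close>, so each gap is
  measurable in \<open>c\<close>, and \<open>sets_ex_zero\<close> handles the quantifier over
  \<open>z\<close>.\<close>

lemma sets_coincide_probe:
  assumes S: "C1_on U S" "S ` U \<subseteq> U" and K: "compact K" "K \<subseteq> U"
    and B: "finite B" "B \<subseteq> C1_space U" and v: "v \<in> C1_space U"
  shows "{c \<in> space (PiM B (\<lambda>_. lborel)). v + (\<Sum>b\<in>B. c b *\<^sub>R b) \<in> coincide U S j k p K}
    \<in> sets (PiM B (\<lambda>_. lborel))"
proof -
  let ?N = "PiM B (\<lambda>_. lborel :: real measure)"
  let ?v = "\<lambda>c. v + (\<Sum>b\<in>B. c b *\<^sub>R b)"
  have in_C1: "?v c \<in> C1_space U" for c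
    using v B subspace_C1_space[of U] by (intro subspace_add subspace_sum subspace_scale) auto
  have comp: "(\<lambda>c. c b) \<in> borel_measurable ?N" if "b \<in> B" for b
    using measurable_component_singleton[OF that, of "\<lambda>_. lborel"] by (simp add: measurable_lborel1)
  have "(\<lambda>c. ?v c x $ j) \<in> borel_measurable ?N" for x
  proof -
    have "?v c x $ j = v x $ j + (\<Sum>b\<in>B. c b * b x $ j)" for c
      by (simp add: sum_fun_apply scaleR_fun_def sum_component)
    then show ?thesis
      using comp by (simp add: borel_measurable_add borel_measurable_sum borel_measurable_times)
  qed
  then have "(\<lambda>c. delay_gap S j k p (?v c) z) \<in> borel_measurable ?N" for z
    unfolding delay_gap_def by (intro borel_measurable_sum borel_measurable_abs borel_measurable_diff)
  then have "{c \<in> space ?N. \<exists>z\<in>K. delay_gap S j k p (?v c) z = 0} \<in> sets ?N"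
    using S K in_C1 by (intro sets_ex_zero continuous_on_delay_gap delay_gap_nonneg) auto
  then show ?thesis
    using in_C1 by (simp add: coincide_eq_gap)
qed

text \<open>Along the directions \<open>h e\<close>, a coincidence at \<open>z\<close> is a square
  linear system for \<open>t\<close> whose matrix consists of the differences of \<open>h e\<close>
  between the orbits of \<open>z\<close> and \<open>p\<close>. Assumption \<open>near\<close> puts
  this matrix close to the identity, \<open>\<gamma>\<close> numbers its rows by delay times, and
  the convex set \<open>K'\<close> yields the Lipschitz bounds.\<close>

lemma shy_coincide:
  fixes h :: "'b::euclidean_space \<Rightarrow> 'a::euclidean_space \<Rightarrow> real" and \<gamma> :: "'b \<Rightarrow> nat"
    and B :: "('a \<Rightarrow> real^'m) set"
  assumes S: "C1_on U S" "S ` U \<subseteq> U"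
    and B: "finite B" "B \<subseteq> C1_space U"
    and h: "\<And>e. e \<in> Basis \<Longrightarrow> C1_on U (h e)" "\<And>e. e \<in> Basis \<Longrightarrow> component_ext U j (h e) \<in> span B"
    and K: "compact K" "small_covers DIM('b) K" "K \<subseteq> K'" and K': "compact K'" "convex K'" "K' \<subseteq> U"
    and p: "p \<in> U"
    and \<gamma>: "bij_betw \<gamma> Basis {..<DIM('b)}"
    and near: "\<And>i e z. i \<in> Basis \<Longrightarrow> e \<in> Basis \<Longrightarrow> z \<in> K \<Longrightarrow>
      \<bar>h e ((S ^^ \<gamma> i) z) - h e ((S ^^ \<gamma> i) p) - (if i = e then 1 else 0)\<bar> \<le> 1 / (2 * real DIM('b))"
  shows "shy (C1_topology U) B (coincide U S j DIM('b) p K)"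
proof (rule shy_if_sections_negligible[where w = "\<lambda>e. component_ext U j (h e)"])
  have KU: "K \<subseteq> U" using K K' by auto
  show "openin (C1_topology U) (topspace (C1_topology U) - coincide U S j DIM('b) p K)"
    unfolding topspace_C1_topology using S K KU p by (intro openin_Compl_coincide) auto
  show "coincide U S j DIM('b) p K \<subseteq> topspace (C1_topology U)"
    unfolding topspace_C1_topology by (auto simp: coincide_def)
  fix v assume "v \<in> topspace (C1_topology U :: ('a \<Rightarrow> real^'m) topology)"
  then have v: "v \<in> C1_space U" by (simp add: topspace_C1_topology)
  show "{c \<in> space (PiM B (\<lambda>_. lborel)). v + (\<Sum>b\<in>B. c b *\<^sub>R b) \<in> coincide U S j DIM('b) p K}
      \<in> sets (PiM B (\<lambda>_. lborel))"
    using S K KU B v by (intro sets_coincide_probe) auto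
  have Lip: "\<exists>L. L-lipschitz_on K (\<lambda>z. f ((S ^^ i) z) - c)" if f: "C1_on U f" for f :: "'a \<Rightarrow> real" and i c
  proof -
    have "C1_on U (\<lambda>z. f ((S ^^ i) z) - c)"
      by (intro C1_on_diff C1_on_const C1_on_funpow f S)
    from C1_on_imp_Lipschitz_on[OF this K'] show ?thesis
      using K(3) lipschitz_on_subset by blast
  qed
  let ?f = "\<lambda>i z. v ((S ^^ \<gamma> i) z) $ j - v ((S ^^ \<gamma> i) p) $ j"
  let ?g = "\<lambda>i e z. h e ((S ^^ \<gamma> i) z) - h e ((S ^^ \<gamma> i) p)"
  have "C1_on U (\<lambda>x. v x $ j)" using v by (auto simp: C1_space_def intro: C1_on_nth)
  then have "negligible {t. \<exists>z\<in>K. \<forall>i\<in>Basis. ?f i z + (\<Sum>e\<in>Basis. (t \<bullet> e) * ?g i e z) = 0}"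
    using near h(1) Lip by (intro negligible_near_identity_system K(2)) auto
  then show "negligible {t. v + (\<Sum>e\<in>Basis. (t \<bullet> e) *\<^sub>R component_ext U j (h e)) \<in> coincide U S j DIM('b) p K}"
  proof (rule negligible_subset, intro subsetI CollectI)
    fix t assume "t \<in> {t. v + (\<Sum>e\<in>Basis. (t \<bullet> e) *\<^sub>R component_ext U j (h e)) \<in> coincide U S j DIM('b) p K}"
    then obtain z where z: "z \<in> K" and eq: "\<And>i. i < DIM('b) \<Longrightarrow>
        (v + (\<Sum>e\<in>Basis. (t \<bullet> e) *\<^sub>R component_ext U j (h e))) ((S ^^ i) z) $ j =
        (v + (\<Sum>e\<in>Basis. (t \<bullet> e) *\<^sub>R component_ext U j (h e))) ((S ^^ i) p) $ j"
      unfolding coincide_def by auto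
    have val: "(v + (\<Sum>e\<in>Basis. (t \<bullet> e) *\<^sub>R component_ext U j (h e))) x $ j =
        v x $ j + (\<Sum>e\<in>Basis. (t \<bullet> e) * h e x)" if "x \<in> U" for x
      using that by (simp add: sum_fun_apply scaleR_fun_def sum_component component_ext_def)
    have "?f i z + (\<Sum>e\<in>Basis. (t \<bullet> e) * ?g i e z) = 0" if i: "i \<in> Basis" for i
    proof -
      have "\<gamma> i < DIM('b)" using \<gamma> i by (auto simp: bij_betw_def)
      from eq[OF this] show ?thesis
        using z KU p funpow_in[OF S(2)]
        by (subst (asm) (1 2) val) (auto simp: right_diff_distrib sum_subtractf)
    qed
    with z show "\<exists>z\<in>K. \<forall>i\<in>Basis. ?f i z + (\<Sum>e\<in>Basis. (t \<bullet> e) * ?g i e z) = 0" by blast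
  qed
qed (use B h in \<open>auto simp: topspace_C1_topology subspace_C1_space\<close>)

lemma shy_coincide_point:
  fixes B :: "('a::euclidean_space \<Rightarrow> real^'m) set"
  assumes S: "C1_on U S" "S ` U \<subseteq> U"
    and B: "finite B" "B \<subseteq> C1_space U"
    and span_B: "\<And>g. g \<in> span (monomials N) \<Longrightarrow> component_ext U j g \<in> span B"
    and N: "N \<ge> 1" and zp: "z \<in> U" "p \<in> U" "z \<noteq> p"
  shows "shy (C1_topology U) B (coincide U S j 1 p {z})"
proof -
  obtain g where g: "g \<in> span (monomials N)" "g z = 1" "g p = 0"
    using polynomial_interpolation[of "{p}" z N] N zp by auto
  have "C1_on U g" by (rule C1_on_span[OF g(1)]) (rule C1_on_monomials)
  \<comment> \<open>The parameter type \<open>real\<close> makes this a system of size 1, whose only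
    coefficient is \<open>g z - g p = 1\<close>.\<close>
  then have "shy (C1_topology U) B (coincide U S j DIM(real) p {z})"
    using S B zp g span_B[OF g(1)]
    by (intro shy_coincide[where h = "\<lambda>_. g" and \<gamma> = "\<lambda>_::real. 0" and K' = "{z}"])
      (auto intro: small_covers_singleton simp: bij_betw_def)
  then show ?thesis by simp
qed

text \<open>As the orbit segment of \<open>p\<close> consists of distinct points and avoids that of
  \<open>z\<^sub>0\<close>, interpolation can make the matrix equal to the identity at
  \<open>z\<^sub>0\<close>; continuity keeps it near the identity on a ball.\<close>

lemma shy_coincide_local:
  fixes B :: "('a::euclidean_space \<Rightarrow> real^'m) set" and p z\<^sub>0 :: 'a
  defines "k \<equiv> CARD('m)"
  assumes U: "open U" and S: "C1_on U S" "S ` U \<subseteq> U"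
    and B: "finite B" "B \<subseteq> C1_space U"
    and span_B: "\<And>g. g \<in> span (monomials N) \<Longrightarrow> component_ext U j g \<in> span B"
    and N: "N \<ge> 2 * k" and zp: "z\<^sub>0 \<in> U" "p \<in> U"
    and A: "compact A" "small_covers k A"
    and inj: "inj_on (\<lambda>i. (S ^^ i) p) {..<k}"
    and disj: "\<And>i l. i < k \<Longrightarrow> l < k \<Longrightarrow> (S ^^ i) z\<^sub>0 \<noteq> (S ^^ l) p"
  shows "\<exists>r>0. shy (C1_topology U) B (coincide U S j k p (A \<inter> cball z\<^sub>0 r))"
proof -
  have k: "DIM(real^'m) = k" by (simp add: k_def)
  obtain \<gamma> :: "real^'m \<Rightarrow> nat" where \<gamma>: "bij_betw \<gamma> Basis {..<k}"
    using ex_bij_betw_finite_nat[OF finite_Basis] unfolding k[symmetric] by (metis atLeast0LessThan)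
  have \<gamma>_lt: "\<gamma> e < k" if "e \<in> Basis" for e using \<gamma> that by (auto simp: bij_betw_def)
  have "\<exists>g\<in>span (monomials N). g ((S ^^ \<gamma> e) p) = 1 \<and>
      (\<forall>u\<in>(\<lambda>i. (S ^^ i) p) ` ({..<k} - {\<gamma> e}) \<union> (\<lambda>i. (S ^^ i) z\<^sub>0) ` {..<k}. g u = 0)"
    if e: "e \<in> Basis" for e
  proof (rule polynomial_interpolation)
    let ?W1 = "(\<lambda>i. (S ^^ i) p) ` ({..<k} - {\<gamma> e})" and ?W2 = "(\<lambda>i. (S ^^ i) z\<^sub>0) ` {..<k}"
    have "card ?W1 \<le> card ({..<k} - {\<gamma> e})" "card ?W2 \<le> card {..<k}"
      by (intro card_image_le; simp)+
    moreover have "card ({..<k} - {\<gamma> e}) \<le> k" by (metis card_Diff1_le card_lessThan finite_lessThan)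
    \<comment> \<open>At most \<open>k\<close> nodes on the orbit of \<open>p\<close> and
      \<open>k\<close> on that of \<open>z\<^sub>0\<close>: this is the origin of the degree
      \<open>2 * k\<close>.\<close>
    ultimately show "card (?W1 \<union> ?W2) \<le> N"
      using card_Un_le[of ?W1 ?W2] N by simp
    show "(S ^^ \<gamma> e) p \<notin> ?W1 \<union> ?W2"
      using inj \<gamma>_lt[OF e] disj[OF _ \<gamma>_lt[OF e]] by (force simp: inj_on_def)
  qed auto
  then have "\<forall>e\<in>Basis. \<exists>g. g \<in> span (monomials N) \<and> g ((S ^^ \<gamma> e) p) = 1 \<and>
      (\<forall>i<k. i \<noteq> \<gamma> e \<longrightarrow> g ((S ^^ i) p) = 0) \<and> (\<forall>i<k. g ((S ^^ i) z\<^sub>0) = 0)"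
    by fast
  from bchoice[OF this] obtain g where
      "\<forall>e\<in>Basis. g e \<in> span (monomials N) \<and> g e ((S ^^ \<gamma> e) p) = 1 \<and>
        (\<forall>i<k. i \<noteq> \<gamma> e \<longrightarrow> g e ((S ^^ i) p) = 0) \<and> (\<forall>i<k. g e ((S ^^ i) z\<^sub>0) = 0)" ..
  then have g: "\<And>e. e \<in> Basis \<Longrightarrow> g e \<in> span (monomials N)"
      "\<And>e. e \<in> Basis \<Longrightarrow> g e ((S ^^ \<gamma> e) p) = 1"
      "\<And>e i. e \<in> Basis \<Longrightarrow> i < k \<Longrightarrow> i \<noteq> \<gamma> e \<Longrightarrow> g e ((S ^^ i) p) = 0"
      "\<And>e i. e \<in> Basis \<Longrightarrow> i < k \<Longrightarrow> g e ((S ^^ i) z\<^sub>0) = 0"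
    by simp_all
  \<comment> \<open>With this sign the matrix of differences \<open>h e (S\<^sup>i z) - h e (S\<^sup>i p)\<close> is the identity
    at \<open>z = z\<^sub>0\<close>.\<close>
  define h where "h e = - g e" for e
  have h: "h e \<in> span (monomials N)" if "e \<in> Basis" for e
    using g(1)[OF that] by (simp add: h_def span_neg)
  have hC1: "C1_on U (h e)" if "e \<in> Basis" for e
    by (rule C1_on_span[OF h[OF that]]) (rule C1_on_monomials)
  have hp: "h e ((S ^^ \<gamma> i) p) = - (if i = e then 1 else 0)" if "e \<in> Basis" "i \<in> Basis" for e i
    using g(2)[OF that(1)] g(3)[OF that(1) \<gamma>_lt[OF that(2)]] \<gamma> that
    by (auto simp: h_def bij_betw_def inj_on_def)
  have "eventually (\<lambda>z. \<forall>i\<in>Basis. \<forall>e\<in>Basis. \<bar>h e ((S ^^ \<gamma> i) z)\<bar> < 1 / (2 * real k)) (nhds z\<^sub>0)"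
  proof (intro eventually_ball_finite ballI finite_Basis)
    fix i e :: "real^'m" assume ie: "i \<in> Basis" "e \<in> Basis"
    have "isCont (\<lambda>z. h e ((S ^^ \<gamma> i) z)) z\<^sub>0"
      using C1_on_imp_continuous_on[OF C1_on_funpow[OF hC1[OF ie(2)] S, of "\<gamma> i"]] U zp(1)
      by (simp add: continuous_on_eq_continuous_at)
    then have "((\<lambda>z. \<bar>h e ((S ^^ \<gamma> i) z)\<bar>) \<longlongrightarrow> \<bar>h e ((S ^^ \<gamma> i) z\<^sub>0)\<bar>) (nhds z\<^sub>0)"
      using tendsto_at_iff_tendsto_nhds[of "\<lambda>z. h e ((S ^^ \<gamma> i) z)" z\<^sub>0]
      by (intro tendsto_rabs) (simp add: isCont_def)
    moreover have "\<bar>h e ((S ^^ \<gamma> i) z\<^sub>0)\<bar> < 1 / (2 * real k)"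
      using g(4)[OF ie(2) \<gamma>_lt[OF ie(1)]] by (simp add: h_def k_def)
    ultimately show "eventually (\<lambda>z. \<bar>h e ((S ^^ \<gamma> i) z)\<bar> < 1 / (2 * real k)) (nhds z\<^sub>0)"
      by (rule order_tendstoD(2))
  qed
  then obtain r1 where r1: "r1 > 0" "\<And>z i e. dist z z\<^sub>0 < r1 \<Longrightarrow> i \<in> Basis \<Longrightarrow> e \<in> Basis \<Longrightarrow>
      \<bar>h e ((S ^^ \<gamma> i) z)\<bar> < 1 / (2 * real k)"
    unfolding eventually_nhds_metric by metis
  obtain r2 where r2: "r2 > 0" "cball z\<^sub>0 r2 \<subseteq> U"
    using U zp(1) open_contains_cball by blast
  \<comment> \<open>Halving \<open>r1\<close> carries the strict estimate over to a closed ball, and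
    \<open>r2\<close> keeps that ball inside \<open>U\<close>.\<close>
  define r where "r = min (r1/2) r2"
  have r: "r > 0" "r < r1" "r \<le> r2" using r1(1) r2(1) by (auto simp: r_def)
  have "shy (C1_topology U) B (coincide U S j DIM(real^'m) p (A \<inter> cball z\<^sub>0 r))"
  proof (rule shy_coincide[OF S B hC1 span_B[OF h], where K' = "cball z\<^sub>0 r" and \<gamma> = \<gamma>])
    show "cball z\<^sub>0 r \<subseteq> U" using r r2 subset_cball[of r r2 z\<^sub>0] by blast
    show "compact (A \<inter> cball z\<^sub>0 r)" using A(1) by (simp add: compact_Int_closed)
    show "small_covers DIM(real^'m) (A \<inter> cball z\<^sub>0 r)"
      unfolding k using A(2) by (rule small_covers_mono) auto
    show "bij_betw \<gamma> Basis {..<DIM(real^'m)}" unfolding k by (rule \<gamma>)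
    fix i e :: "real^'m" and z
    assume ie: "i \<in> Basis" "e \<in> Basis" and z: "z \<in> A \<inter> cball z\<^sub>0 r"
    \<comment> \<open>The values at \<open>p\<close> cancel the identity matrix exactly, so the
      deviation is just the value at \<open>z\<close>.\<close>
    have "\<bar>h e ((S ^^ \<gamma> i) z)\<bar> < 1 / (2 * real k)"
      using z r by (intro r1(2) ie) (auto simp: dist_commute)
    then show "\<bar>h e ((S ^^ \<gamma> i) z) - h e ((S ^^ \<gamma> i) p) - (if i = e then 1 else 0)\<bar> \<le> 1 / (2 * real DIM(real^'m))"
      unfolding k hp[OF ie(2,1)] by simp
  qed (use zp in auto)
  then show ?thesis using r(1) unfolding k by blast
qed

text \<open>The local argument treats all \<open>z\<close> whose orbit segment is disjoint from that
  of \<open>p\<close>. The others are finitely many by injectivity of \<open>S\<close> and are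
  separated from \<open>p\<close> individually by a single evaluation.\<close>

lemma shy_delay_coincidence:
  fixes B :: "('a::euclidean_space \<Rightarrow> real^'m) set" and p :: 'a
  defines "k \<equiv> CARD('m)"
  assumes U: "open U" and S: "C1_on U S" "S ` U \<subseteq> U" "inj_on S U"
    and B: "finite B" "B \<subseteq> C1_space U"
    and span_B: "\<And>g. g \<in> span (monomials N) \<Longrightarrow> component_ext U j g \<in> span B"
    and N: "N \<ge> 2 * k" and p: "p \<in> U"
    and A: "compact A" "A \<subseteq> U" "small_covers k A"
    and inj: "inj_on (\<lambda>i. (S ^^ i) p) {..<k}"
  shows "shy (C1_topology U) B
    {Y \<in> C1_space U. \<exists>z\<in>A - {p}. \<forall>i<k. Y ((S ^^ i) z) $ j = Y ((S ^^ i) p) $ j}"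
proof -
  have "k \<ge> 1" unfolding k_def by (simp add: Suc_leI)
  define Z where "Z = (\<Union>i<k. \<Union>l<k. {z \<in> U. (S ^^ i) z = (S ^^ l) p})"
  have inj_pow: "inj_on (S ^^ i) U" for i
  proof (induction i)
    case (Suc i)
    then show ?case
      using S(3) funpow_in[OF S(2)] by (auto simp: inj_on_def)
  qed simp
  have "finite {z \<in> U. (S ^^ i) z = q}" for i q
    using finite_vimage_IntI[OF _ inj_pow, of "{q}" i] by (simp add: vimage_def Int_def conj_commute)
  then have "finite Z" unfolding Z_def by auto
  have "\<exists>r>0. shy (C1_topology U) B (coincide U S j k p (A \<inter> cball z r))" if "z \<in> A - Z" for z
    using that A(2) unfolding k_def
    by (intro shy_coincide_local[OF U S(1,2) B span_B N[unfolded k_def] _ p A(1) A(3)[unfolded k_def] inj[unfolded k_def]])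
      (auto simp: Z_def k_def)
  then obtain r where r: "\<And>z. z \<in> A - Z \<Longrightarrow> r z > 0"
      "\<And>z. z \<in> A - Z \<Longrightarrow> shy (C1_topology U) B (coincide U S j k p (A \<inter> cball z (r z)))" by metis
  \<comment> \<open>\<open>A - Z\<close> need not be compact, so the Lindelof property supplies a
    countable subcover, which \<open>shy_UN\<close> can handle.\<close>
  let ?balls = "(\<lambda>z. ball z (r z)) ` (A - Z)"
  have "\<And>V. V \<in> ?balls \<Longrightarrow> open V" by auto
  then obtain F where F: "F \<subseteq> ?balls" "countable F" "\<Union>F = \<Union>?balls"
    by (rule Lindelof)
  obtain D where D: "countable D" "D \<subseteq> A - Z" "F = (\<lambda>z. ball z (r z)) ` D"
    using F(1,2) countable_subset_image[of F "\<lambda>z. ball z (r z)" "A - Z"] by blast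
  \<comment> \<open>The point \<open>p\<close> belongs to \<open>Z\<close>, through
    \<open>i = l = 0\<close>, and has to be taken out.\<close>
  have "shy (C1_topology U) B ((\<Union>z\<in>Z - {p}. coincide U S j 1 p {z}) \<union>
      (\<Union>z\<in>D. coincide U S j k p (A \<inter> cball z (r z))))"
  proof (intro shy_Un shy_UN)
    show "shy (C1_topology U) B (coincide U S j 1 p {z})" if "z \<in> Z - {p}" for z
      using that p N \<open>k \<ge> 1\<close> by (intro shy_coincide_point[OF S(1,2) B, where N = N] span_B) (auto simp: Z_def)
  qed (use D r(2) \<open>finite Z\<close> in \<open>auto simp: countable_finite\<close>)
  then show ?thesis
  proof (rule shy_mono, intro subsetI)
    fix Y :: "'a \<Rightarrow> real^'m"
    assume "Y \<in> {Y \<in> C1_space U. \<exists>z\<in>A - {p}. \<forall>i<k. Y ((S ^^ i) z) $ j = Y ((S ^^ i) p) $ j}"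
    then obtain z where Y: "Y \<in> C1_space U" and z: "z \<in> A" "z \<noteq> p"
        and eq: "\<And>i. i < k \<Longrightarrow> Y ((S ^^ i) z) $ j = Y ((S ^^ i) p) $ j" by auto
    show "Y \<in> (\<Union>z\<in>Z - {p}. coincide U S j 1 p {z}) \<union> (\<Union>z\<in>D. coincide U S j k p (A \<inter> cball z (r z)))"
    proof (cases "z \<in> Z")
      case True
      then have "Y \<in> coincide U S j 1 p {z}" using Y eq[of 0] \<open>k \<ge> 1\<close> by (auto simp: coincide_def)
      then show ?thesis using True z by blast
    next
      case False
      then have "z \<in> \<Union>F" unfolding F(3) using r(1)[of z] z by force
      then obtain d where d: "d \<in> D" "z \<in> ball d (r d)" using D(3) by auto
      then have "Y \<in> coincide U S j k p (A \<inter> cball d (r d))"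
        using Y eq z by (auto simp: coincide_def intro!: bexI[of _ z])
      then show ?thesis using d by blast
    qed
  qed
qed

section \<open>Invariant measures\<close>

context
  fixes U :: "'a::euclidean_space set" and \<mu> :: "'a measure"
  assumes U: "open U" and \<mu>: "\<mu> \<in> borel_prob_on U"
begin

section \<open>The support of a measure on an open set\<close>

lemma sets_\<mu>: "sets \<mu> = sets (restrict_space borel U)"
  using \<mu> by (simp add: borel_prob_on_def)

lemma space_\<mu>: "space \<mu> = U"
  using sets_eq_imp_space_eq[OF sets_\<mu>] by (simp add: space_restrict_space)

lemma prob_space_\<mu>: "prob_space \<mu>"
  using \<mu> by (simp add: borel_prob_on_def)

lemma openin_sets: "openin (top_of_set U) V \<Longrightarrow> V \<in> sets \<mu>"
  using U by (auto simp: sets_\<mu> sets_restrict_space_iff openin_open)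

lemma closedin_sets: "closedin (top_of_set U) V \<Longrightarrow> V \<in> sets \<mu>"
  using U by (auto simp: sets_\<mu> sets_restrict_space_iff closedin_closed)

lemma emeasure_Compl_eq_1_iff:
  assumes "V \<in> sets \<mu>"
  shows "emeasure \<mu> (U - V) = 1 \<longleftrightarrow> emeasure \<mu> V = 0"
proof -
  interpret prob_space \<mu> by (rule prob_space_\<mu>)
  show ?thesis
    using prob_compl[OF assms] by (auto simp: emeasure_eq_measure space_\<mu> ennreal_eq_1)
qed

lemma measurable_\<mu>_continuous:
  fixes f :: "'a \<Rightarrow> real"
  assumes "continuous_on U f"
  shows "f \<in> borel_measurable \<mu>"
  using borel_measurable_continuous_on_restrict[OF assms] measurable_cong_sets[OF sets_\<mu> refl] by blast

text \<open>The support arises by removing all open null sets; by the Lindelof property countably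
  many of them have the same union, so the removed part is null.\<close>

lemma measure_supp_props:
  shows closedin_measure_supp: "closedin (top_of_set U) (measure_supp \<mu>)"
    and emeasure_measure_supp: "emeasure \<mu> (measure_supp \<mu>) = 1"
    and measure_supp_least: "\<And>D. closedin (top_of_set U) D \<Longrightarrow> emeasure \<mu> D = 1 \<Longrightarrow> measure_supp \<mu> \<subseteq> D"
proof -
  let ?is = "\<lambda>C. closedin (top_of_set (space \<mu>)) C \<and> emeasure \<mu> C = 1 \<and>
     (\<forall>D. closedin (top_of_set (space \<mu>)) D \<and> emeasure \<mu> D = 1 \<longrightarrow> C \<subseteq> D)"
  define \<F> where "\<F> = {V. open V \<and> emeasure \<mu> (V \<inter> U) = 0}"
  obtain \<F>' where \<F>': "\<F>' \<subseteq> \<F>" "countable \<F>'" "\<Union>\<F>' = \<Union>\<F>"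
    using Lindelof[of \<F>] unfolding \<F>_def by blast
  define C where "C = U - \<Union>\<F>"
  have "(\<Union>V\<in>\<F>'. V \<inter> U) \<in> null_sets \<mu>"
  proof (intro null_sets_UN' \<F>'(2))
    fix V assume "V \<in> \<F>'"
    then have V: "open V" "emeasure \<mu> (V \<inter> U) = 0" using \<F>'(1) by (auto simp: \<F>_def)
    then have "V \<inter> U \<in> sets \<mu>" by (intro openin_sets) (simp add: openin_open_Int Int_commute)
    with V(2) show "V \<inter> U \<in> null_sets \<mu>" by (simp add: null_sets_def)
  qed
  moreover have "C = U - (\<Union>V\<in>\<F>'. V \<inter> U)" using \<F>'(3) unfolding C_def by blast
  ultimately have "emeasure \<mu> C = 1"
    using emeasure_Compl_eq_1_iff by (auto simp: null_sets_def)
  moreover have "closedin (top_of_set U) C"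
  proof -
    have "open (\<Union>\<F>)" unfolding \<F>_def by (intro open_Union) auto
    then have "closed (- \<Union>\<F>)" by auto
    moreover have "C = U \<inter> - \<Union>\<F>" unfolding C_def by auto
    ultimately show ?thesis by (auto simp: closedin_closed)
  qed
  moreover have "C \<subseteq> D" if D: "closedin (top_of_set U) D" "emeasure \<mu> D = 1" for D
  proof -
    have "openin (top_of_set U) (U - D)" using D(1) by (metis openin_diff openin_subtopology_self)
    then obtain V where V: "open V" "U - D = U \<inter> V" unfolding openin_open by blast
    have "emeasure \<mu> (U - D) = 0"
    proof -
      have "U - (U - D) = D" using closedin_imp_subset[OF D(1)] by auto
      then show ?thesis
        using emeasure_Compl_eq_1_iff[of "U - D"] D openin_sets[OF \<open>openin _ (U - D)\<close>] by simp
    qed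
    then have "V \<in> \<F>" using V by (simp add: \<F>_def Int_commute)
    then show ?thesis using V(2) unfolding C_def by blast
  qed
  ultimately have ex: "?is C" unfolding space_\<mu> by blast
  \<comment> \<open>Two least sets contain each other, so \<open>C\<close> is the only candidate for
    the definite description.\<close>
  have "?is (measure_supp \<mu>)"
    unfolding measure_supp_def by (rule theI[where P = ?is, OF ex]) (use ex in blast)
  then show "closedin (top_of_set U) (measure_supp \<mu>)" "emeasure \<mu> (measure_supp \<mu>) = 1"
    "\<And>D. closedin (top_of_set U) D \<Longrightarrow> emeasure \<mu> D = 1 \<Longrightarrow> measure_supp \<mu> \<subseteq> D"
    unfolding space_\<mu> by blast+
qed

lemma measure_supp_subset: "measure_supp \<mu> \<subseteq> U"
  using closedin_measure_supp closedin_imp_subset by blast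

lemma emeasure_nbhd_measure_supp:
  assumes "x \<in> measure_supp \<mu>" "openin (top_of_set U) V" "x \<in> V"
  shows "emeasure \<mu> V \<noteq> 0"
proof
  assume "emeasure \<mu> V = 0"
  then have "emeasure \<mu> (U - V) = 1" using emeasure_Compl_eq_1_iff[OF openin_sets[OF assms(2)]] by simp
  moreover have "closedin (top_of_set U) (U - V)" using assms(2) by (metis closedin_diff closedin_subtopology_refl subset_UNIV topspace_euclidean)
  ultimately show False using measure_supp_least assms by blast
qed

text \<open>The preimage of the support is relatively closed and, by invariance, of full measure, so
  leastness puts the support inside it.\<close>

lemma invariant_measure_supp:
  assumes "continuous_on U T" "T ` U \<subseteq> U" "invariant_measure T \<mu>"
  shows "T ` measure_supp \<mu> \<subseteq> measure_supp \<mu>"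
proof -
  have T: "T \<in> measurable \<mu> \<mu>" "distr \<mu> \<mu> T = \<mu>" using assms(3) by (auto simp: invariant_measure_def)
  have "emeasure \<mu> (U \<inter> T -` measure_supp \<mu>) = emeasure (distr \<mu> \<mu> T) (measure_supp \<mu>)"
    by (subst emeasure_distr[OF T(1) closedin_sets[OF closedin_measure_supp]]) (simp add: space_\<mu> Int_commute)
  then have "emeasure \<mu> (U \<inter> T -` measure_supp \<mu>) = 1" using T(2) emeasure_measure_supp by simp
  moreover have "closedin (top_of_set U) (U \<inter> T -` measure_supp \<mu>)"
    using assms(1,2) closedin_measure_supp by (intro continuous_closedin_preimage_gen) auto
  ultimately show ?thesis using measure_supp_least by blast
qed

text \<open>A tent function around \<open>z\<close> has zero averages along an orbit that stays at
  distance \<open>r\<close>, but a positive integral because \<open>z\<close> lies in the support;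
  for a point of the basin the two would agree in the limit.\<close>

lemma basin_orbit_dense:
  assumes x: "x \<in> basin U \<mu> T" and z: "z \<in> measure_supp \<mu>" and "r > 0"
  shows "\<exists>k. dist ((T ^^ k) x) z < r"
proof (rule ccontr)
  assume "\<nexists>k. dist ((T ^^ k) x) z < r"
  then have far: "dist ((T ^^ k) x) z \<ge> r" for k by (simp add: not_less)
  interpret prob_space \<mu> by (rule prob_space_\<mu>)
  define \<phi> where "\<phi> y = max 0 (r - dist y z)" for y
  have cont: "continuous_on U \<phi>" unfolding \<phi>_def[abs_def] by (intro continuous_intros)
  then have "(\<lambda>N. (\<Sum>k<N. \<phi> ((T ^^ k) x)) / real N) \<longlonglongrightarrow> integral\<^sup>L \<mu> \<phi>"
    using x by (simp add: basin_def)
  moreover have "\<phi> ((T ^^ k) x) = 0" for k using far[of k] by (simp add: \<phi>_def)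
  ultimately have "(\<lambda>N::nat. 0) \<longlonglongrightarrow> integral\<^sup>L \<mu> \<phi>" by simp
  then have "integral\<^sup>L \<mu> \<phi> = 0" by (simp add: LIMSEQ_const_iff)
  moreover have "integrable \<mu> \<phi>"
    using \<open>r > 0\<close> by (intro integrable_const_bound[where B = r] measurable_\<mu>_continuous cont) (auto simp: \<phi>_def)
  ultimately have "AE y in \<mu>. \<phi> y = 0"
    by (subst (asm) integral_nonneg_eq_0_iff_AE) (auto simp: \<phi>_def)
  then have "AE y in \<mu>. y \<notin> U \<inter> ball z r"
    by (rule AE_mp) (auto intro!: AE_I2 simp: \<phi>_def dist_commute max_def split: if_splits)
  moreover have op: "openin (top_of_set U) (U \<inter> ball z r)" by (auto simp: openin_open)
  ultimately have "emeasure \<mu> (U \<inter> ball z r) = 0"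
    using AE_iff_null_sets[OF openin_sets[OF op]] by auto
  moreover have "z \<in> U \<inter> ball z r" using z measure_supp_subset \<open>r > 0\<close> by auto
  ultimately show False using emeasure_nbhd_measure_supp[OF z op] by blast
qed

text \<open>If no \<open>z\<close> matched, compactness would leave a gap \<open>\<delta>\<close>,
  and the neighbourhood of that radius about the \<open>T\<close>-delay vector of \<open>x\<close>
  would have measure 0 for \<open>S\<close> and positive measure for \<open>T\<close>.\<close>

lemma delay_measure_eq_imp_delay_eq:
  assumes y: "continuous_on U y"
    and T: "continuous_on U T" "T ` U \<subseteq> U" and S: "continuous_on U S" "S ` U \<subseteq> U"
    and comp: "compact (measure_supp \<mu>)"
    and eq: "delay_measure \<mu> y T k = delay_measure \<mu> y S k"
    and x: "x \<in> measure_supp \<mu>"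
  shows "\<exists>z\<in>measure_supp \<mu>. \<forall>i<k. y ((T ^^ i) x) = y ((S ^^ i) z)"
proof (rule ccontr)
  assume none: "\<not> ?thesis"
  let ?A = "measure_supp \<mu>" and ?P = "PiM {..<k} (\<lambda>_. borel :: real measure)"
  have cont: "continuous_on U (\<lambda>z. y ((R ^^ i) z))" if "continuous_on U R" "R ` U \<subseteq> U" for R i
  proof -
    have "continuous_on U (R ^^ i)"
    proof (induction i)
      case (Suc i)
      have "continuous_on U (\<lambda>z. R ((R ^^ i) z))"
        by (rule continuous_on_compose2[OF that(1) Suc]) (use funpow_in[OF that(2)] in auto)
      then show ?case by (simp add: o_def)
    qed (simp add: id_def)
    then show ?thesis
      by (rule continuous_on_compose2[OF y]) (use funpow_in[OF that(2)] in auto)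
  qed
  \<comment> \<open>For either map the distance is taken to the \<open>T\<close>-delay vector of
    \<open>x\<close>, so \<open>\<phi> T x = 0\<close>.\<close>
  define \<phi> where "\<phi> R z = (\<Sum>i<k. \<bar>y ((R ^^ i) z) - y ((T ^^ i) x)\<bar>)" for R :: "'a \<Rightarrow> 'a" and z
  have cont_phi: "continuous_on U (\<phi> R)" if "continuous_on U R" "R ` U \<subseteq> U" for R
    unfolding \<phi>_def by (intro continuous_intros cont that)
  have "?A \<noteq> {}" using x by auto
  moreover have "continuous_on ?A (\<phi> S)"
    using cont_phi[OF S] measure_supp_subset continuous_on_subset by blast
  ultimately obtain z0 where z0: "z0 \<in> ?A" "\<And>z. z \<in> ?A \<Longrightarrow> \<phi> S z0 \<le> \<phi> S z"
    using continuous_attains_inf[OF comp] by blast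
  define \<delta> where "\<delta> = \<phi> S z0"
  have "\<phi> S z0 \<noteq> 0"
  proof
    assume "\<phi> S z0 = 0"
    then have "\<forall>i<k. y ((T ^^ i) x) = y ((S ^^ i) z0)"
      unfolding \<phi>_def by (subst (asm) sum_nonneg_eq_0_iff) auto
    with none z0(1) show False by blast
  qed
  moreover have "\<phi> S z0 \<ge> 0" unfolding \<phi>_def by (simp add: sum_nonneg)
  ultimately have "\<delta> > 0" unfolding \<delta>_def by simp
  define W where "W = {w \<in> space ?P. (\<Sum>i<k. \<bar>w i - y ((T ^^ i) x)\<bar>) < \<delta>}"
  have "(\<lambda>w. \<Sum>i<k. \<bar>w i - y ((T ^^ i) x)\<bar>) \<in> borel_measurable ?P"
    by (intro borel_measurable_sum borel_measurable_abs borel_measurable_diff borel_measurable_const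
        measurable_component_singleton) auto
  then have W: "W \<in> sets ?P" unfolding W_def by measurable
  have delay: "emeasure (delay_measure \<mu> y R k) W = emeasure \<mu> {z \<in> U. \<phi> R z < \<delta>}"
    if "continuous_on U R" "R ` U \<subseteq> U" for R
  proof -
    have "delay_map y R k \<in> measurable \<mu> ?P"
      unfolding delay_map_def[abs_def]
      by (intro measurable_restrict measurable_\<mu>_continuous cont that)
    moreover have "delay_map y R k -` W \<inter> space \<mu> = {z \<in> U. \<phi> R z < \<delta>}"
      by (auto simp: W_def \<phi>_def delay_map_def space_\<mu> space_PiM)
    ultimately show ?thesis
      unfolding delay_measure_def using W by (simp add: emeasure_distr)
  qed
  have openin: "openin (top_of_set U) {z \<in> U. \<phi> R z < \<delta>}" if "continuous_on U R" "R ` U \<subseteq> U" for R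
    using continuous_openin_preimage_gen[OF cont_phi[OF that], of "{..<\<delta>}"]
    by (simp add: vimage_def Int_def)
  \<comment> \<open>By minimality of \<open>z0\<close> this sublevel set misses the support.\<close>
  have "emeasure \<mu> {z \<in> U. \<phi> S z < \<delta>} = 0"
  proof -
    have "?A \<in> sets \<mu>" by (intro closedin_sets closedin_measure_supp)
    moreover have "U - (U - ?A) = ?A" using measure_supp_subset by auto
    ultimately have "emeasure \<mu> (U - ?A) = 0"
      using emeasure_Compl_eq_1_iff[of "U - ?A"] emeasure_measure_supp space_\<mu> by (metis sets.compl_sets)
    moreover have "{z \<in> U. \<phi> S z < \<delta>} \<subseteq> U - ?A" using z0(2) unfolding \<delta>_def by force
    moreover have "U - ?A \<in> sets \<mu>" using \<open>?A \<in> sets \<mu>\<close> space_\<mu> by (metis sets.compl_sets)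
    ultimately show ?thesis by (metis emeasure_mono le_zero_eq)
  qed
  then have "emeasure \<mu> {z \<in> U. \<phi> T z < \<delta>} = 0"
    using delay[OF T] delay[OF S] eq by simp
  moreover have "x \<in> {z \<in> U. \<phi> T z < \<delta>}"
    using x measure_supp_subset \<open>\<delta> > 0\<close> by (auto simp: \<phi>_def)
  ultimately show False using emeasure_nbhd_measure_supp[OF x openin[OF T]] by blast
qed

end

lemma diffeo_onD:
  assumes "diffeo_on U T"
  shows "C1_on U T" "T ` U \<subseteq> U" "inj_on T U"
  using assms by (auto simp: diffeo_on_def bij_betw_def)

section \<open>Orbits\<close>

lemma funpow_inj:
  assumes "inj_on T U" "T ` U \<subseteq> U" "x \<in> U" "y \<in> U" "(T ^^ k) x = (T ^^ k) y"
  shows "x = y"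
  using assms(5)
proof (induction k)
  case (Suc k)
  then show ?case
    using assms funpow_in[OF assms(2)] by (auto dest: inj_onD)
qed simp

text \<open>Time \<open>b\<close> is identified with time \<open>a\<close>, so the orbit never
  leaves its first \<open>b\<close> points.\<close>

lemma finite_orbit_if_recurrent:
  fixes T :: "'a \<Rightarrow> 'a"
  assumes "(T ^^ a) x = (T ^^ b) x" "a < b"
  shows "range (\<lambda>k. (T ^^ k) x) = (\<lambda>k. (T ^^ k) x) ` {..<b}"
proof -
  have "(T ^^ k) x \<in> (\<lambda>k. (T ^^ k) x) ` {..<b}" for k
  proof (induction k)
    case 0
    then show ?case using assms(2) by (intro image_eqI[of _ _ 0]) auto
  next
    case (Suc k)
    then obtain l where l: "l < b" "(T ^^ k) x = (T ^^ l) x" by auto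
    show ?case
    proof (cases "Suc l = b")
      case True
      then have "(T ^^ Suc k) x = (T ^^ a) x" using l assms(1) by auto
      then show ?thesis using assms(2) by auto
    next
      case False
      then show ?thesis using l by (intro image_eqI[of _ _ "Suc l"]) auto
    qed
  qed
  then show ?thesis by auto
qed

text \<open>For \<open>n \<ge> k\<close>, consider the delay vectors starting at time
  \<open>n - k\<close>: their first \<open>k\<close> entries identify the matching point by
  \<open>emb\<close>, and the extra entry compares the two orbits at time \<open>n\<close>.\<close>

lemma orbits_agree:
  fixes Y :: "'a::euclidean_space \<Rightarrow> real^'m"
  defines "k \<equiv> CARD('m)"
  assumes U: "T ` U \<subseteq> U" "inj_on T U" "x \<in> U"
    and orbit: "\<And>i. (T ^^ i) x \<in> A"
    and dist: "inj_on (\<lambda>i. (T ^^ i) x) {..<k}"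
    and init: "\<And>i. i < k \<Longrightarrow> (T ^^ i) x = (S ^^ i) x"
    and sep: "\<And>i. (T ^^ i) x \<noteq> (S ^^ i) x \<Longrightarrow> Y ((T ^^ i) x) \<noteq> Y ((S ^^ i) x)"
    and emb: "\<And>n j z. \<lbrakk>inj_on (\<lambda>i. (S ^^ i) ((T ^^ n) x)) {..<k}; z \<in> A;
        \<forall>i<k. Y ((S ^^ i) z) $ j = Y ((S ^^ i) ((T ^^ n) x)) $ j\<rbrakk> \<Longrightarrow> z = (T ^^ n) x"
    and delay: "\<And>w j. w \<in> A \<Longrightarrow> \<exists>z\<in>A. \<forall>i<k + 1. Y ((T ^^ i) w) $ j = Y ((S ^^ i) z) $ j"
  shows "(T ^^ n) x = (S ^^ n) x"
proof (induction n rule: less_induct)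
  case (less n)
  show ?case
  proof (cases "n < k")
    case False
    define l where "l = n - k"
    have n: "n = k + l" using False by (simp add: l_def)
    let ?p = "(T ^^ l) x"
    \<comment> \<open>Positivity of \<open>k\<close> gives \<open>l < n\<close>, so the induction
      hypothesis covers time \<open>l\<close>.\<close>
    have k: "k > 0" unfolding k_def by simp
    have Sp: "(S ^^ i) ?p = (T ^^ i) ?p" if "i < k" for i
    proof -
      have "?p = (S ^^ l) x" using less n k by simp
      then have "(S ^^ i) ?p = (S ^^ (i + l)) x" by (simp add: funpow_add)
      also have "\<dots> = (T ^^ (i + l)) x" using less that n by simp
      finally show ?thesis by (simp add: funpow_add)
    qed
    \<comment> \<open>Injectivity of \<open>T ^^ l\<close> carries distinctness from the start of
      the orbit to time \<open>l\<close>.\<close>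
    have "inj_on (\<lambda>i. (T ^^ i) ?p) {..<k}"
    proof (rule inj_onI)
      fix a b assume ab: "a \<in> {..<k}" "b \<in> {..<k}" "(T ^^ a) ?p = (T ^^ b) ?p"
      have "(T ^^ c) ?p = (T ^^ l) ((T ^^ c) x)" for c
        by (metis add.commute comp_apply funpow_add)
      then have "(T ^^ l) ((T ^^ a) x) = (T ^^ l) ((T ^^ b) x)" using ab(3) by simp
      then have "(T ^^ a) x = (T ^^ b) x"
        by (rule funpow_inj[OF U(2,1) funpow_in[OF U(1,3)] funpow_in[OF U(1,3)]])
      then show "a = b" using dist ab by (auto dest: inj_onD)
    qed
    then have inj: "inj_on (\<lambda>i. (S ^^ i) ?p) {..<k}"
      using Sp by (subst inj_on_cong[of _ _ "\<lambda>i. (T ^^ i) ?p"]) auto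
    have "Y ((T ^^ n) x) $ j = Y ((S ^^ n) x) $ j" for j
    proof -
      \<comment> \<open>The matching point may a priori depend on \<open>j\<close>.\<close>
      obtain z where z: "z \<in> A" "\<forall>i<k + 1. Y ((T ^^ i) ?p) $ j = Y ((S ^^ i) z) $ j"
        using delay[OF orbit] by blast
      then have "z = ?p" using Sp by (intro emb[OF inj, where j = j]) auto
      \<comment> \<open>Index \<open>k\<close> is the last of the \<open>k + 1\<close> delay
        coordinates, the one beyond those used by \<open>emb\<close>.\<close>
      then have "Y ((T ^^ k) ?p) $ j = Y ((S ^^ k) ?p) $ j" using z(2) by simp
      moreover have "?p = (S ^^ l) x" using less n k by simp
      ultimately show ?thesis by (simp add: n funpow_add)
    qed
    then show ?thesis using sep[of n] by (auto simp: vec_eq_iff)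
  qed (use init in auto)
qed

section \<open>Assembly of the exceptional sets\<close>

theorem theoremS3p2:
  fixes U :: "(real^'n) set" and T S :: "real^'n \<Rightarrow> real^'n"
    and \<mu> :: "(real^'n) measure" and d :: real
  assumes "open U"
    and "diffeo_on U T" and "diffeo_on U S"
    and "\<mu> \<in> borel_prob_on U"
    and "invariant_measure T \<mu>" and "invariant_measure S \<mu>"
    and "compact (measure_supp \<mu>)"
    and "has_box_dim (measure_supp \<mu>) d"
    and "real CARD('m) > 2 * d"
    and "periodic_point_assumption T (measure_supp \<mu>) CARD('m)"
    and "periodic_point_assumption S (measure_supp \<mu>) CARD('m)"
  shows "almost_every (C1_topology U) (\<lambda>Y :: real^'n \<Rightarrow> real^'m.
    (\<exists>x \<in> basin U \<mu> T \<inter> measure_supp \<mu>.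
        \<forall>k\<in>{1..CARD('m) - 1}. (T ^^ k) x = (S ^^ k) x) \<and>
    (\<forall>j. delay_measure \<mu> (\<lambda>x. Y x $ j) T (CARD('m) + 1) =
         delay_measure \<mu> (\<lambda>x. Y x $ j) S (CARD('m) + 1))
    \<longrightarrow> (\<forall>x \<in> measure_supp \<mu>. T x = S x))" (is "almost_every _ ?P")
proof -
  let ?A = "measure_supp \<mu>" and ?k = "CARD('m)" and ?X = "C1_topology U :: (real^'n \<Rightarrow> real^'m) topology"
  note U = \<open>open U\<close> and comp = \<open>compact ?A\<close>
  note T = diffeo_onD[OF \<open>diffeo_on U T\<close>] and S = diffeo_onD[OF \<open>diffeo_on U S\<close>]
  note Tc = C1_on_imp_continuous_on[OF T(1)] and Sc = C1_on_imp_continuous_on[OF S(1)]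
  note supp = U \<open>\<mu> \<in> borel_prob_on U\<close>
  note AU = measure_supp_subset[OF supp]
  obtain B :: "(real^'n \<Rightarrow> real^'m) set" where B: "finite B" "independent B" "B \<subseteq> C1_space U"
    and span_B: "\<And>g j. g \<in> span (monomials (2 * ?k)) \<Longrightarrow> component_ext U j g \<in> span B"
    by (rule polynomial_probe_exists[OF U, where N = "2 * ?k" and 'm = 'm]) (rule that)
  have "small_covers ?k ?A"
  proof (rule small_covers_if_box_dim[OF \<open>has_box_dim ?A d\<close>])
    have "real ?k > 0" by simp
    then show "d < real ?k" using \<open>real ?k > 2 * d\<close> by linarith
  qed
  note delay_shy = shy_delay_coincidence[OF U S B(1,3) span_B order_refl _ comp AU this]
  have ae: "almost_every ?X ?P" if "shy ?X B {Y \<in> topspace ?X. \<not> ?P Y}"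
    using B that by (intro almost_every_if_shy[of B]) (auto simp: topspace_C1_topology subspace_C1_space)
  show ?thesis
  proof (cases "\<exists>x \<in> basin U \<mu> T \<inter> ?A. \<forall>k\<in>{1..?k - 1}. (T ^^ k) x = (S ^^ k) x")
    case False
    \<comment> \<open>If no such point exists, the implication is vacuous for every
      \<open>Y\<close>.\<close>
    then have "{Y \<in> topspace ?X. \<not> ?P Y} = {}" by blast
    then show ?thesis by (intro ae) (simp only: shy_empty)
  next
    case True
    then obtain x where x: "x \<in> basin U \<mu> T" "x \<in> ?A"
      and "\<forall>k\<in>{1..?k - 1}. (T ^^ k) x = (S ^^ k) x" by blast
    \<comment> \<open>Index 0, outside the range of hypothesis (1), is trivial.\<close>
    then have init: "(T ^^ i) x = (S ^^ i) x" if "i < ?k" for i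
      using that by (cases "i = 0") auto
    have orbT: "(T ^^ i) x \<in> ?A" for i
      by (rule funpow_in[OF invariant_measure_supp[OF supp Tc T(2) \<open>invariant_measure T \<mu>\<close>] x(2)])
    have orbS: "(S ^^ i) x \<in> ?A" for i
      by (rule funpow_in[OF invariant_measure_supp[OF supp Sc S(2) \<open>invariant_measure S \<mu>\<close>] x(2)])
    have dense: "?A \<subseteq> closure (range (\<lambda>i. (T ^^ i) x))"
      using basin_orbit_dense[OF supp x(1)] by (auto simp: closure_approachable)
    \<comment> \<open>Agreement is a closed condition on the support, so the dense orbit decides
      it.\<close>
    have agree: "\<forall>z\<in>?A. T z = S z" if on_orbit: "\<And>i. T ((T ^^ i) x) = S ((T ^^ i) x)"
    proof -
      let ?E = "{z \<in> ?A. T z = S z}"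
      have "continuous_on ?A (\<lambda>z. T z - S z)"
        using Tc Sc AU by (intro continuous_on_diff) (rule continuous_on_subset, assumption+)+
      then have "closed ?E"
        using continuous_closed_preimage_constant[OF _ compact_imp_closed[OF comp], of _ 0] by fastforce
      then have "closure (range (\<lambda>i. (T ^^ i) x)) \<subseteq> ?E"
        using on_orbit orbT by (intro closure_minimal) auto
      then show ?thesis using dense by blast
    qed
    show ?thesis
    proof (cases "inj_on (\<lambda>i. (T ^^ i) x) {..<?k}")
      case False
      then obtain a b where ab: "a < b" "b < ?k" "(T ^^ a) x = (T ^^ b) x"
        unfolding inj_on_def by (metis lessThan_iff linorder_neqE_nat)
      have "T ((T ^^ i) x) = S ((T ^^ i) x)" for i
      proof -
        obtain l where l: "l < b" "(T ^^ i) x = (T ^^ l) x"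
          using finite_orbit_if_recurrent[OF ab(3,1)] by (metis (no_types, lifting) imageE lessThan_iff rangeI)
        \<comment> \<open>From \<open>l < b < ?k\<close> there is room for \<open>Suc l\<close> in
          \<open>init\<close>.\<close>
        have "T ((T ^^ l) x) = (S ^^ Suc l) x" using init[of "Suc l"] l ab(2) by simp
        then show ?thesis using init[of l] l ab(2) by simp
      qed
      then have "{Y \<in> topspace ?X. \<not> ?P Y} = {}" using agree by blast
      then show ?thesis by (intro ae) (simp only: shy_empty)
    next
      case True
      let ?p = "\<lambda>n. (T ^^ n) x"
      \<comment> \<open>These sets of times depend on \<open>T\<close>, \<open>S\<close> and
        \<open>x\<close> but not on \<open>Y\<close>, so the union of the exceptional sets is
        countable.\<close>
      let ?I = "{n. ?p n \<noteq> (S ^^ n) x}" and ?J = "{n. inj_on (\<lambda>i. (S ^^ i) (?p n)) {..<?k}}"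
      \<comment> \<open>Two points are separated as soon as one component separates them, and any
        component will do.\<close>
      obtain j0 :: 'm where True by simp
      let ?Q1 = "\<Union>n\<in>?I. coincide U S j0 1 (?p n) {(S ^^ n) x}"
      let ?Q2 = "\<Union>n\<in>?J. \<Union>j. {Y \<in> C1_space U. \<exists>z\<in>?A - {?p n}. \<forall>i<?k.
        Y ((S ^^ i) z) $ j = Y ((S ^^ i) (?p n)) $ j}"
      have "shy ?X B (?Q1 \<union> ?Q2)"
      proof (intro shy_Un shy_UN)
        fix n assume "n \<in> ?I"
        then show "shy ?X B (coincide U S j0 1 (?p n) {(S ^^ n) x})"
          using orbT orbS AU by (intro shy_coincide_point[OF S(1,2) B(1,3), where N = "2 * ?k"] span_B) (auto simp: Suc_leI)
      next
        fix n j assume "n \<in> ?J"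
        then show "shy ?X B {Y \<in> C1_space U. \<exists>z\<in>?A - {?p n}. \<forall>i<?k.
            Y ((S ^^ i) z) $ j = Y ((S ^^ i) (?p n)) $ j}"
          using orbT AU by (intro delay_shy) auto
      qed (auto intro: countable_finite)
      moreover have "{Y \<in> topspace ?X. \<not> ?P Y} \<subseteq> ?Q1 \<union> ?Q2"
      proof (intro subsetI, rule ccontr)
        fix Y assume "Y \<in> {Y \<in> topspace ?X. \<not> ?P Y}" and notin: "Y \<notin> ?Q1 \<union> ?Q2"
        then have Y: "Y \<in> C1_space U"
          and delay_eq: "\<And>j. delay_measure \<mu> (\<lambda>x. Y x $ j) T (?k + 1) = delay_measure \<mu> (\<lambda>x. Y x $ j) S (?k + 1)"
          and differ: "\<not> (\<forall>x \<in> ?A. T x = S x)"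
          by (auto simp: topspace_C1_topology)
        have Yc: "continuous_on U (\<lambda>x. Y x $ j)" for j
          using Y by (intro C1_on_imp_continuous_on C1_on_nth) (simp add: C1_space_def)
        have eq: "?p n = (S ^^ n) x" for n
        proof (rule orbits_agree[where Y = Y and A = ?A and U = U])
          show "x \<in> U" using x(2) AU by blast
          show "Y (?p i) \<noteq> Y ((S ^^ i) x)" if "?p i \<noteq> (S ^^ i) x" for i
            using notin Y that by (auto simp: coincide_def)
          show "z = ?p n" if "inj_on (\<lambda>i. (S ^^ i) (?p n)) {..<?k}" "z \<in> ?A"
            "\<forall>i<?k. Y ((S ^^ i) z) $ j = Y ((S ^^ i) (?p n)) $ j" for n j z
            using notin Y that by blast
          show "\<exists>z\<in>?A. \<forall>i<?k + 1. Y ((T ^^ i) w) $ j = Y ((S ^^ i) z) $ j" if "w \<in> ?A" for w j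
            by (rule delay_measure_eq_imp_delay_eq[OF supp Yc Tc T(2) Sc S(2) comp delay_eq that])
        qed (use T orbT True init in auto)
        have "T (?p i) = S (?p i)" for i
          using eq[of "Suc i"] eq[of i] by simp
        then show False using agree differ by blast
      qed
      ultimately have "shy ?X B {Y \<in> topspace ?X. \<not> ?P Y}" by (rule shy_mono)
      then show ?thesis by (rule ae)
    qed
  qed
qed

end
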